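(* Let $G_1,\ldots,G_t$ be finite groups ($t\geq 1$) and put $\mathcal{W}=\mathsf{V}(\mathcal{P}(G_1)^0,\ldots,\mathcal{P}(G_t)^0)$. Let $H$ be a finite group with $|H|\geq 3$, and let $\mathcal{U}$ be an ai-semiring variety with $\mathsf{V}(\mathcal{P}(H))\subseteq\mathcal{U}\subseteq\mathcal{W}$. Then $\mathcal{U}^0\subseteq\mathcal{W}$, and every ai-semiring variety $\mathcal{V}$ with $\mathcal{U}\subseteq\mathcal{V}\subseteq\mathcal{U}^0$ has infinite axiomatic rank and is nonfinitely based.
   Context: An additively idempotent semiring (ai-semiring) is an algebra $(S,+,\cdot)$ with two binary operations (no constants in the signature) such that $(S,+)$ is a commutative idempotent semigroup, $(S,\cdot)$ is a semigroup, and multiplication distributes over addition on both sides. For a semigroup $S$, $\mathcal{P}(S)$ is the ai-semiring of all nonempty subsets of $S$ with $A+B=A\cup B$ and $AB=\{ab:a\in A,\ b\in B\}$; $\mathcal{P}(S)^0$ is the ai-semiring of all subsets of $S$ (including $\varnothing$) with the same operations. For any ai-semiring $S$, $S^0=S\cup\{0\}$ is obtained by adjoining a new element $0$ with $a+0=0+a=a$ and $a0=0a=0$ for all $a\in S^0$. $\mathsf{V}(\ldots)$ or $\mathsf{V}\{\ldots\}$ denotes the variety generated by the listed ai-semirings. For an ai-semiring variety $\mathcal{U}$, $\mathcal{U}^0=\mathsf{V}\{S^0:S\in\mathcal{U}\}$. A variety is finitely based if its identities admit a finite basis, and nonfinitely based otherwise. A variety has infinite axiomatic rank if, for every positive integer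 $k$, its identities involving at most $k$ variables do not form a basis for all its identities. *)

theory Defs
  imports "HOL-Algebra.Coset" "HOL-Library.Countable_Set"
begin

section \<open>Additively idempotent semirings\<close>

text \<open>The signature consists of the two binary operations only. In particular there is no constant
  for a zero or a one, so the ring record of HOL-Algebra is not used.\<close>

record 'a ai_semiring = "'a partial_object" +
  plus_op :: "'a \<Rightarrow> 'a \<Rightarrow> 'a"
  times_op :: "'a \<Rightarrow> 'a \<Rightarrow> 'a"

definition is_ai_semiring :: "'a ai_semiring \<Rightarrow> bool" where
  "is_ai_semiring S \<longleftrightarrow>
     carrier S \<noteq> {} \<and>
     (\<forall>a\<in>carrier S. \<forall>b\<in>carrier S. plus_op S a b \<in> carrier S \<and> times_op S a b \<in> carrier S) \<and>
     (\<forall>a\<in>carrier S. \<forall>b\<in>carrier S. \<forall>c\<in>carrier S.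
        plus_op S (plus_op S a b) c = plus_op S a (plus_op S b c)) \<and>
     (\<forall>a\<in>carrier S. \<forall>b\<in>carrier S. plus_op S a b = plus_op S b a) \<and>
     (\<forall>a\<in>carrier S. plus_op S a a = a) \<and>
     (\<forall>a\<in>carrier S. \<forall>b\<in>carrier S. \<forall>c\<in>carrier S.
        times_op S (times_op S a b) c = times_op S a (times_op S b c)) \<and>
     (\<forall>a\<in>carrier S. \<forall>b\<in>carrier S. \<forall>c\<in>carrier S.
        times_op S a (plus_op S b c) = plus_op S (times_op S a b) (times_op S a c)) \<and>
     (\<forall>a\<in>carrier S. \<forall>b\<in>carrier S. \<forall>c\<in>carrier S.
        times_op S (plus_op S a b) c = plus_op S (times_op S a c) (times_op S b c))"

definition power_semiring :: "('a, 'b) monoid_scheme \<Rightarrow> 'a set ai_semiring" where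
  "power_semiring G =
     \<lparr>carrier = {A. A \<subseteq> carrier G \<and> A \<noteq> {}}, plus_op = (\<union>), times_op = set_mult G\<rparr>"

definition power_semiring0 :: "('a, 'b) monoid_scheme \<Rightarrow> 'a set ai_semiring" where
  "power_semiring0 G = \<lparr>carrier = Pow (carrier G), plus_op = (\<union>), times_op = set_mult G\<rparr>"

fun plus0 :: "'a ai_semiring \<Rightarrow> 'a option \<Rightarrow> 'a option \<Rightarrow> 'a option" where
  "plus0 S None y = y"
| "plus0 S x None = x"
| "plus0 S (Some a) (Some b) = Some (plus_op S a b)"

fun times0 :: "'a ai_semiring \<Rightarrow> 'a option \<Rightarrow> 'a option \<Rightarrow> 'a option" where
  "times0 S (Some a) (Some b) = Some (times_op S a b)"
| "times0 S _ _ = None"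

definition adjoin_zero :: "'a ai_semiring \<Rightarrow> 'a option ai_semiring" where
  "adjoin_zero S =
     \<lparr>carrier = insert None (Some ` carrier S), plus_op = plus0 S, times_op = times0 S\<rparr>"


section \<open>Identities and varieties\<close>

datatype ai_term = Var nat | Sum ai_term ai_term | Prod ai_term ai_term

primrec term_vars :: "ai_term \<Rightarrow> nat set" where
  "term_vars (Var n) = {n}"
| "term_vars (Sum s t) = term_vars s \<union> term_vars t"
| "term_vars (Prod s t) = term_vars s \<union> term_vars t"

primrec term_val :: "'a ai_semiring \<Rightarrow> (nat \<Rightarrow> 'a) \<Rightarrow> ai_term \<Rightarrow> 'a" where
  "term_val S \<rho> (Var n) = \<rho> n"
| "term_val S \<rho> (Sum s t) = plus_op S (term_val S \<rho> s) (term_val S \<rho> t)"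
| "term_val S \<rho> (Prod s t) = times_op S (term_val S \<rho> s) (term_val S \<rho> t)"

type_synonym identity = "ai_term \<times> ai_term"

definition identity_vars :: "identity \<Rightarrow> nat set" where
  "identity_vars e = term_vars (fst e) \<union> term_vars (snd e)"

definition satisfies :: "'a ai_semiring \<Rightarrow> identity \<Rightarrow> bool" where
  "satisfies S e \<longleftrightarrow>
     (\<forall>\<rho>. (\<forall>n. \<rho> n \<in> carrier S) \<longrightarrow> term_val S \<rho> (fst e) = term_val S \<rho> (snd e))"

definition identities :: "'a ai_semiring set \<Rightarrow> identity set" where
  "identities K = {e. \<forall>S\<in>K. satisfies S e}"

definition models :: "identity set \<Rightarrow> 'a ai_semiring set" where
  "models \<Sigma> = {S. is_ai_semiring S \<and> (\<forall>e\<in>\<Sigma>. satisfies S e)}"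

text \<open>A class of algebras is represented by its members whose carrier is a subset of a type \<open>'a\<close>,
  the universe. If \<open>'a\<close> is infinite then every countable algebra has an isomorphic copy there. Since
  an identity that fails in an algebra already fails in a countable subalgebra, a variety is then
  determined by its members in \<open>'a\<close>; see \<open>identities_models_universe\<close> below. For a finite universe
  this is false, hence statements about varieties must assume \<open>infinite (UNIV :: 'a set)\<close>.\<close>

definition is_variety :: "'a ai_semiring set \<Rightarrow> bool" where
  "is_variety V \<longleftrightarrow> (\<exists>\<Sigma>. V = models \<Sigma>)"

text \<open>The generators may live in another universe than the variety they generate: \<open>S\<^sup>0\<close> is an
  algebra on \<open>'a option\<close>, and the power semiring of a group on \<open>'g\<close> is an algebra on \<open>'g set\<close>.\<close>

definition generated_variety :: "'b ai_semiring set \<Rightarrow> 'a ai_semiring set" where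
  "generated_variety K = models (identities K)"

definition variety0 :: "'a ai_semiring set \<Rightarrow> 'a ai_semiring set" where
  "variety0 U = generated_variety (adjoin_zero ` U)"

text \<open>Being a basis is understood within ai-semirings: the axioms of ai-semirings (finitely many,
  in at most three variables) come for free.\<close>

definition is_basis :: "identity set \<Rightarrow> 'a ai_semiring set \<Rightarrow> bool" where
  "is_basis \<Sigma> V \<longleftrightarrow>
     \<Sigma> \<subseteq> identities V \<and> identities V \<subseteq> identities (models \<Sigma> :: 'a ai_semiring set)"

definition finitely_based :: "'a ai_semiring set \<Rightarrow> bool" where
  "finitely_based V \<longleftrightarrow> (\<exists>\<Sigma>. finite \<Sigma> \<and> is_basis \<Sigma> V)"

definition infinite_axiomatic_rank :: "'a ai_semiring set \<Rightarrow> bool" where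
  "infinite_axiomatic_rank V \<longleftrightarrow>
     (\<forall>k\<ge>1. \<not> is_basis {e \<in> identities V. card (identity_vars e) \<le> k} V)"


section \<open>Basic properties\<close>

lemma is_ai_semiring_power_semiring:
  assumes "group G"
  shows "is_ai_semiring (power_semiring G)"
proof -
  interpret group G by fact
  have "carrier G \<in> {A. A \<subseteq> carrier G \<and> A \<noteq> {}}" by auto
  moreover have "A <#>\<^bsub>G\<^esub> B \<noteq> {}" if "A \<noteq> {}" "B \<noteq> {}" for A B
    using that unfolding set_mult_def by auto
  moreover have "A <#>\<^bsub>G\<^esub> B \<subseteq> carrier G" if "A \<subseteq> carrier G" "B \<subseteq> carrier G" for A B
    using that by (rule set_mult_closed)
  ultimately show ?thesis
    unfolding is_ai_semiring_def power_semiring_def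
    by (simp add: set_mult_assoc Un_assoc Un_commute) (auto simp: set_mult_def)
qed

lemma is_ai_semiring_power_semiring0:
  assumes "group G"
  shows "is_ai_semiring (power_semiring0 G)"
proof -
  interpret group G by fact
  have "A <#>\<^bsub>G\<^esub> B \<subseteq> carrier G" if "A \<subseteq> carrier G" "B \<subseteq> carrier G" for A B
    using that by (rule set_mult_closed)
  then show ?thesis
    unfolding is_ai_semiring_def power_semiring0_def
    by (simp add: set_mult_assoc Un_assoc Un_commute) (auto simp: set_mult_def)
qed

lemma is_ai_semiring_adjoin_zero:
  assumes "is_ai_semiring S"
  shows "is_ai_semiring (adjoin_zero S)"
  using assms unfolding is_ai_semiring_def adjoin_zero_def by auto

lemma generated_variety_contains:
  fixes K :: "'a ai_semiring set"
  assumes "\<And>S. S \<in> K \<Longrightarrow> is_ai_semiring S"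
  shows "K \<subseteq> generated_variety K"
  using assms unfolding generated_variety_def models_def identities_def by auto

lemma generated_variety_least:
  fixes K :: "'a ai_semiring set"
  assumes "is_variety V" "K \<subseteq> V"
  shows "generated_variety K \<subseteq> V"
  using assms unfolding is_variety_def generated_variety_def models_def identities_def by blast

instance ai_term :: countable
  by countable_datatype

lemma term_val_closed:
  assumes "is_ai_semiring S" "\<And>n. \<rho> n \<in> carrier S"
  shows "term_val S \<rho> t \<in> carrier S"
  using assms by (induction t) (auto simp: is_ai_semiring_def)

lemma identities_models_universe:
  assumes inf: "infinite (UNIV :: 'u set)"
  shows "identities (models \<Sigma> :: 'u ai_semiring set) \<subseteq> identities (models \<Sigma> :: 'a ai_semiring set)"
proof -
  have "term_val S \<rho> (fst e) = term_val S \<rho> (snd e)"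
    if e: "e \<in> identities (models \<Sigma> :: 'u ai_semiring set)"
      and S: "S \<in> models \<Sigma>" and \<rho>: "\<forall>n. \<rho> n \<in> carrier S"
    for e and S :: "'a ai_semiring" and \<rho>
  proof -
    have ais: "is_ai_semiring S" using S by (simp add: models_def)
    define T where "T = range (term_val S \<rho>)"
    have sub: "T \<subseteq> carrier S" using term_val_closed[OF ais] \<rho> by (auto simp: T_def)
    have "countable T" by (simp add: T_def)
    obtain h :: "nat \<Rightarrow> 'u" where h: "inj h"
      using inf infinite_countable_subset by blast
    define f where "f = h \<circ> to_nat_on T"
    have f: "inj_on f T"
      unfolding f_def using \<open>countable T\<close> h
      by (intro comp_inj_on inj_on_to_nat_on) (auto intro: inj_on_subset)
    define g where "g = the_inv_into T f"
    have gf: "g (f x) = x" if "x \<in> T" for x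
      using that f by (simp add: g_def the_inv_into_f_f)
    have pT: "plus_op S x y \<in> T" "times_op S x y \<in> T" if xy: "x \<in> T" "y \<in> T" for x y
    proof -
      obtain s t where "x = term_val S \<rho> s" "y = term_val S \<rho> t" using xy by (auto simp: T_def)
      then have "plus_op S x y = term_val S \<rho> (Sum s t)" "times_op S x y = term_val S \<rho> (Prod s t)"
        by auto
      then show "plus_op S x y \<in> T" "times_op S x y \<in> T" unfolding T_def by blast+
    qed
    define B :: "'u ai_semiring" where
      "B = \<lparr>carrier = f ` T, plus_op = (\<lambda>x y. f (plus_op S (g x) (g y))),
            times_op = (\<lambda>x y. f (times_op S (g x) (g y)))\<rparr>"
    have "T \<noteq> {}" by (simp add: T_def)
    have B: "is_ai_semiring B"
      using ais sub \<open>T \<noteq> {}\<close> unfolding is_ai_semiring_def B_def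
      by (simp add: gf pT subset_iff) metis
    have val: "term_val B (f \<circ> \<tau>) t = f (term_val S \<tau> t) \<and> term_val S \<tau> t \<in> T"
      if "\<forall>n. \<tau> n \<in> T" for \<tau> t
      using that by (induction t) (auto simp: B_def gf pT)
    have "satisfies B d" if "d \<in> \<Sigma>" for d
      unfolding satisfies_def
    proof (intro allI impI)
      fix \<tau> :: "nat \<Rightarrow> 'u" assume \<tau>: "\<forall>n. \<tau> n \<in> carrier B"
      have gT: "\<forall>n. (g \<circ> \<tau>) n \<in> T"
        using \<tau> gf by (auto simp: B_def) (metis imageE)
      have fg: "f \<circ> (g \<circ> \<tau>) = \<tau>"
        using \<tau> gf by (auto simp: B_def fun_eq_iff) (metis imageE)
      have "term_val S (g \<circ> \<tau>) (fst d) = term_val S (g \<circ> \<tau>) (snd d)"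
        using S that gT sub unfolding models_def satisfies_def by blast
      then show "term_val B \<tau> (fst d) = term_val B \<tau> (snd d)"
        using val[OF gT, unfolded fg] by metis
    qed
    then have "B \<in> models \<Sigma>" using B by (simp add: models_def)
    then have "satisfies B e" using e by (auto simp: identities_def)
    moreover have \<rho>T: "\<forall>n. \<rho> n \<in> T"
      unfolding T_def by (metis rangeI term_val.simps(1))
    ultimately have "term_val B (f \<circ> \<rho>) (fst e) = term_val B (f \<circ> \<rho>) (snd e)"
      by (auto simp: satisfies_def B_def)
    then show ?thesis using val[OF \<rho>T] inj_onD[OF f] by metis
  qed
  then show ?thesis unfolding identities_def[of "models \<Sigma> :: 'a ai_semiring set"] satisfies_def
    by auto
qed

end

theory Submission
  imports Defs "HOL-Library.Multiset" "HOL-Library.Set_Algebras" "HOL-Library.Product_Plus"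
begin

text \<open>A digraph on \<open>{0..N}\<close> with all arcs \<open>i < j\<close> gives the inequality
  \<open>x\<^sub>0 \<dots> x\<^sub>N \<le> \<Sum> x\<^sub>0 \<dots> x\<^sub>i x\<^sub>j\<^sub>+\<^sub>1 \<dots> x\<^sub>N\<close>, summed over the arcs \<open>(i, j)\<close>. It holds in
  \<open>\<P>(G)\<^sup>0\<close> as soon as the digraph is not \<open>|G|\<close>-colourable: colour \<open>i\<close> by the prefix product
  \<open>g\<^sub>0 \<dots> g\<^sub>i\<close>; for a monochromatic arc the factor \<open>g\<^sub>i\<^sub>+\<^sub>1 \<dots> g\<^sub>j\<close> cancels. On the other hand it fails
  in the syntactic semiring of the set \<open>L\<close> of (commutative) words on the right hand side. If every
  subgraph with at most \<open>2\<^sup>k\<close> arcs is bipartite, that semiring satisfies all identities of \<open>\<P>(H)\<close>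
  in \<open>k\<close> variables: such an identity only sees \<open>2\<^sup>k\<close> arcs, and a group with at least three elements
  has enough proper colourings of a bipartite graph to prevent any word outside \<open>L\<close> from being
  derived. Iterated line digraphs of transitive tournaments provide the digraphs.\<close>

section \<open>Locally bipartite digraphs with large chromatic number\<close>

text \<open>Induction on \<open>k\<close> by passing to the line digraph. This costs a logarithm in
  the chromatic number, hence \<open>n\<close> is arbitrary. In exchange, \<open>k + 1\<close> arcs
  of the line digraph have at most \<open>k\<close> vertices that are both heads and tails, and a
  2-colouring of \<open>E\<close> that is proper on these arcs of \<open>E\<close> suffices.\<close>

lemma ex_locally_bipartite_digraph:
  "\<exists>E :: (nat \<times> nat) set. finite E \<and> (\<forall>(i, j)\<in>E. i < j) \<and>
     (\<forall>F\<subseteq>E. card F \<le> k \<longrightarrow> (\<exists>\<chi> :: nat \<Rightarrow> bool. \<forall>(i, j)\<in>F. \<chi> i \<noteq> \<chi> j)) \<and>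
     (\<forall>p :: nat \<Rightarrow> nat. (\<forall>i. p i < n) \<longrightarrow> (\<exists>(i, j)\<in>E. p i = p j))"
proof (induction k arbitrary: n)
  case 0
  \<comment> \<open>The transitive tournament on \<open>n + 1\<close> vertices.\<close>
  define E where "E = {(i, j). i < j \<and> j \<le> n}"
  have "E \<subseteq> {..n} \<times> {..n}" by (auto simp: E_def)
  then have fin: "finite E" by (rule finite_subset) auto
  have "\<exists>(i, j)\<in>E. p i = p j" if "\<forall>i. p i < n" for p :: "nat \<Rightarrow> nat"
  proof -
    have "card (p ` {..n}) \<le> card {..<n}" by (rule card_mono) (use that in auto)
    then have "\<not> inj_on p {..n}" using pigeonhole[of p "{..n}"] by auto
    then obtain i j where "i \<le> n" "j \<le> n" "i \<noteq> j" "p i = p j" unfolding inj_on_def by blast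
    then have "(min i j, max i j) \<in> E" "p (min i j) = p (max i j)"
      by (auto simp: E_def min_def max_def)
    then show ?thesis by blast
  qed
  moreover have "\<exists>\<chi> :: nat \<Rightarrow> bool. \<forall>(i, j)\<in>F. \<chi> i \<noteq> \<chi> j" if "F \<subseteq> E" "card F \<le> 0" for F
  proof -
    have "F = {}" using that fin finite_subset by fastforce
    then show ?thesis by simp
  qed
  ultimately show ?case using fin by (intro exI[of _ E]) (auto simp: E_def)
next
  case (Suc k)
  obtain E :: "(nat \<times> nat) set" where fin: "finite E" and asc: "\<And>i j. (i, j) \<in> E \<Longrightarrow> i < j"
    and bip: "\<And>F. F \<subseteq> E \<Longrightarrow> card F \<le> k \<Longrightarrow> \<exists>\<chi> :: nat \<Rightarrow> bool. \<forall>(i, j)\<in>F. \<chi> i \<noteq> \<chi> j"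
    and col: "\<And>p :: nat \<Rightarrow> nat. (\<And>i. p i < 2 ^ n) \<Longrightarrow> \<exists>(i, j)\<in>E. p i = p j"
    using Suc.IH[of "2 ^ n"] by auto
  obtain M where M: "\<And>i j. (i, j) \<in> E \<Longrightarrow> j < M"
  proof -
    have "finite (snd ` E)" using fin by simp
    then have "j < Suc (Max (snd ` E))" if "(i, j) \<in> E" for i j
      using Max_ge[OF \<open>finite (snd ` E)\<close> rev_image_eqI[OF that]] by (simp add: less_Suc_eq_le)
    then show ?thesis using that by blast
  qed
  define f where "f = (\<lambda>(i, j). i * M + j)"
  have f_inj: "i = i' \<and> j = j'" if "f (i, j) = f (i', j')" "j < M" "j' < M" for i j i' j'
  proof -
    have "f (i, j) div M = i" "f (i, j) mod M = j" "f (i', j') div M = i'" "f (i', j') mod M = j'"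
      using that(2,3) by (auto simp: f_def)
    then show ?thesis using that(1) by metis
  qed
  define g where "g = the_inv_into E f"
  have "inj_on f E"
  proof (rule inj_onI)
    fix a b assume ab: "a \<in> E" "b \<in> E" "f a = f b"
    obtain i j where a: "a = (i, j)" by fastforce
    obtain i' j' where b: "b = (i', j')" by fastforce
    show "a = b" using f_inj[of i j i' j'] M[of i j] M[of i' j'] ab by (simp add: a b)
  qed
  then have gf: "g (f e) = e" if "e \<in> E" for e using that by (simp add: g_def the_inv_into_f_f)
  \<comment> \<open>the line digraph of \<open>E\<close>, with the arc \<open>(i, j)\<close> encoded as the number \<open>i * M + j\<close>\<close>
  define D where "D = {(f (i, j), f (j, l)) | i j l. (i, j) \<in> E \<and> (j, l) \<in> E}"
  have Dasc: "a < b" if "(a, b) \<in> D" for a b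
  proof -
    obtain i j l where e: "a = f (i, j)" "b = f (j, l)" "(i, j) \<in> E" "(j, l) \<in> E"
      using \<open>(a, b) \<in> D\<close> by (auto simp: D_def)
    have "i * M + j < Suc i * M" using M[OF e(3)] by simp
    also have "\<dots> \<le> j * M" using asc[OF e(3)] by (intro mult_le_mono1) simp
    finally show ?thesis using e by (simp add: f_def)
  qed
  have "D \<subseteq> f ` E \<times> f ` E" by (auto simp: D_def)
  then have finD: "finite D" by (rule finite_subset) (use fin in auto)
  have Dcol: "\<exists>(a, b)\<in>D. p a = p b" if p: "\<forall>i. p i < n" for p :: "nat \<Rightarrow> nat"
  proof (rule ccontr)
    assume neg: "\<not> (\<exists>(a, b)\<in>D. p a = p b)"
    obtain h where h: "bij_betw h (Pow {..<n}) {0..<card (Pow {..<n})}"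
      using ex_bij_betw_finite_nat[of "Pow {..<n}"] by auto
    \<comment> \<open>Colour a vertex of \<open>E\<close> by the set of colours of its outgoing
      arcs, one of \<open>2 ^ n\<close> sets. If \<open>i\<close> and \<open>j\<close> agree for an
      arc \<open>(i, j)\<close>, then some arc leaving \<open>j\<close> has the colour of
      \<open>(i, j)\<close>.\<close>
    define out where "out i = {p (f (i, j)) | j. (i, j) \<in> E}" for i
    have out: "out i \<in> Pow {..<n}" for i using p by (auto simp: out_def)
    have "h (out i) < 2 ^ n" for i
      using bij_betwE[OF h] out[of i] by (auto simp: card_Pow)
    from col[of "\<lambda>i. h (out i)", OF this] obtain i j where ij: "(i, j) \<in> E" "h (out i) = h (out j)" by auto
    have "out i = out j" using inj_onD[OF bij_betw_imp_inj_on[OF h] ij(2)] out by blast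
    moreover have "p (f (i, j)) \<in> out i" using ij by (auto simp: out_def)
    ultimately obtain l where "(j, l) \<in> E" "p (f (i, j)) = p (f (j, l))" by (auto simp: out_def)
    then have "(f (i, j), f (j, l)) \<in> D" "p (f (i, j)) = p (f (j, l))"
      using ij(1) by (auto simp: D_def)
    then show False using neg by blast
  qed
  have Dbip: "\<exists>\<chi> :: nat \<Rightarrow> bool. \<forall>(a, b)\<in>F. \<chi> a \<noteq> \<chi> b" if F: "F \<subseteq> D" "card F \<le> Suc k" for F
  proof (cases "F = {}")
    case False
    have finF: "finite F" using F finD finite_subset by blast
    \<comment> \<open>The arcs of \<open>E\<close> with both an incoming and an outgoing arc in \<open>F\<close>: there are fewer of them than
      arcs in \<open>F\<close>, as they are distinct sources of arcs of \<open>F\<close> other than the least source.\<close>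
    define F' where "F' = {v \<in> E. f v \<in> fst ` F \<and> f v \<in> snd ` F}"
    have "f ` F' \<subseteq> fst ` F - {Min (fst ` F)}"
    proof -
      have "Min (fst ` F) \<noteq> b" if "(a, b) \<in> F" for a b
      proof -
        have "Min (fst ` F) \<le> a" using that finF by (intro Min_le) force+
        then show ?thesis using Dasc[of a b] that F by auto
      qed
      then show ?thesis by (force simp: F'_def)
    qed
    then have "card (f ` F') \<le> card (fst ` F - {Min (fst ` F)})" using finF by (intro card_mono) auto
    also have "\<dots> < card (fst ` F)" using finF False by (intro card_Diff1_less) auto
    also have "\<dots> \<le> card F" using finF by (rule card_image_le)
    finally have "card (f ` F') \<le> k" using F by simp
    moreover have "inj_on f F'" using \<open>inj_on f E\<close> by (rule inj_on_subset) (auto simp: F'_def)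
    ultimately have "card F' \<le> k" by (simp add: card_image)
    then obtain \<chi> :: "nat \<Rightarrow> bool" where \<chi>: "\<And>i j. (i, j) \<in> F' \<Longrightarrow> \<chi> i \<noteq> \<chi> j"
      using bip[of F'] by (auto simp: F'_def)
    \<comment> \<open>A vertex \<open>(i, j)\<close> of the line digraph takes the colour of
      \<open>i\<close> if it is a head in \<open>F\<close>, and the opposite of the colour of
      \<open>j\<close> otherwise. For a tail of an arc in \<open>F\<close> both rules give the
      opposite of \<open>\<chi> j\<close>, the first one because \<chi> is proper on
      \<open>F'\<close>.\<close>
    define \<psi> where "\<psi> v = (if v \<in> snd ` F then \<chi> (fst (g v)) else \<not> \<chi> (snd (g v)))" for v
    have "\<psi> a \<noteq> \<psi> b" if ab: "(a, b) \<in> F" for a b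
    proof -
      obtain i j l where e: "a = f (i, j)" "b = f (j, l)" "(i, j) \<in> E" "(j, l) \<in> E"
        using subsetD[OF F(1) ab] by (auto simp: D_def)
      have "\<psi> b = \<chi> j" using that e gf by (force simp: \<psi>_def)
      moreover have "\<psi> a = (\<not> \<chi> j)"
      proof (cases "a \<in> snd ` F")
        case True
        then have "(i, j) \<in> F'" using that e by (force simp: F'_def)
        then show ?thesis using True e gf \<chi> by (simp add: \<psi>_def)
      qed (use e gf in \<open>simp add: \<psi>_def\<close>)
      ultimately show ?thesis by simp
    qed
    then show ?thesis by (intro exI[of _ \<psi>]) auto
  qed auto
  show ?case
  proof (intro exI[of _ D] conjI allI impI)
    show "\<forall>(a, b)\<in>D. a < b" using Dasc by auto
  qed (fact finD Dcol Dbip)+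
qed

section \<open>Values of terms in semirings of sets\<close>

text \<open>Evaluation in sets under union and elementwise addition. For multisets, addition is the
  product of commutative words.\<close>

primrec set_val :: "(nat \<Rightarrow> 'b::plus set) \<Rightarrow> ai_term \<Rightarrow> 'b set" where
  "set_val \<rho> (Var n) = \<rho> n"
| "set_val \<rho> (Sum s t) = set_val \<rho> s \<union> set_val \<rho> t"
| "set_val \<rho> (Prod s t) = set_val \<rho> s + set_val \<rho> t"

text \<open>\<open>M\<close> is a monomial in the expansion of \<open>t\<close>, regarded as a
  multiset of variables.\<close>

lemma set_val_singletonD:
  fixes \<phi> :: "nat \<Rightarrow> 'b multiset"
  assumes "w \<in> set_val (\<lambda>n. {\<phi> n}) t"
  shows "\<exists>M. set_mset M \<subseteq> term_vars t \<and> w = (\<Sum>n\<in>#M. \<phi> n)"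
  using assms
proof (induction t arbitrary: w)
  case (Var n)
  then show ?case by (intro exI[of _ "{#n#}"]) auto
next
  case (Prod s t)
  then obtain u v where uv: "u \<in> set_val (\<lambda>n. {\<phi> n}) s" "v \<in> set_val (\<lambda>n. {\<phi> n}) t" "w = u + v"
    by (auto simp: set_plus_def)
  then obtain M M' where "set_mset M \<subseteq> term_vars s" "u = (\<Sum>n\<in>#M. \<phi> n)"
    "set_mset M' \<subseteq> term_vars t" "v = (\<Sum>n\<in>#M'. \<phi> n)"
    using Prod.IH by meson
  then show ?case using uv by (intro exI[of _ "M + M'"]) auto
qed (auto, blast+)

lemma set_val_singleton_var:
  fixes \<phi> :: "nat \<Rightarrow> 'b multiset"
  assumes "n \<in> term_vars t"
  shows "\<exists>w\<in>set_val (\<lambda>n. {\<phi> n}) t. \<phi> n \<subseteq># w"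
proof -
  have ne: "set_val (\<lambda>n. {\<phi> n}) t \<noteq> {}" for t by (induction t) (auto simp: set_plus_def)
  show ?thesis using assms
  proof (induction t)
    case (Prod s t)
    obtain u v where "u \<in> set_val (\<lambda>n. {\<phi> n}) s" "v \<in> set_val (\<lambda>n. {\<phi> n}) t"
      "\<phi> n \<subseteq># u \<or> \<phi> n \<subseteq># v"
      using Prod ne[of s] ne[of t] by auto
    then show ?case
      by (intro bexI[of _ "u + v"]) (auto simp: set_plus_def intro: subset_mset.add_increasing subset_mset.add_increasing2)
  qed auto
qed

text \<open>\<open>M\<close> records the monomial that produces \<open>w\<close> together with the
  word picked at each occurrence of a variable. By the last clause the monomial can be reused with
  any other words in place of the picked ones.\<close>

lemma set_val_picks:
  fixes \<rho> :: "nat \<Rightarrow> 'b multiset set"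
  assumes "w \<in> set_val \<rho> t"
  shows "\<exists>M. (\<forall>(n, x)\<in>#M. n \<in> term_vars t \<and> x \<in> \<rho> n) \<and> w = (\<Sum>(n, x)\<in>#M. x) \<and>
    (\<forall>\<phi> :: nat \<Rightarrow> 'b multiset. (\<Sum>(n, x)\<in>#M. \<phi> n) \<in> set_val (\<lambda>n. {\<phi> n}) t)"
  using assms
proof (induction t arbitrary: w)
  case (Var n)
  then show ?case by (intro exI[of _ "{#(n, w)#}"]) auto
next
  case (Prod s t)
  then obtain u v where uv: "u \<in> set_val \<rho> s" "v \<in> set_val \<rho> t" "w = u + v"
    by (auto simp: set_plus_def)
  from Prod.IH(1)[OF uv(1)] Prod.IH(2)[OF uv(2)] obtain M M' where
    "\<forall>(n, x)\<in>#M. n \<in> term_vars s \<and> x \<in> \<rho> n" "u = (\<Sum>(n, x)\<in>#M. x)"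
    "\<forall>\<phi> :: nat \<Rightarrow> 'b multiset. (\<Sum>(n, x)\<in>#M. \<phi> n) \<in> set_val (\<lambda>n. {\<phi> n}) s"
    "\<forall>(n, x)\<in>#M'. n \<in> term_vars t \<and> x \<in> \<rho> n" "v = (\<Sum>(n, x)\<in>#M'. x)"
    "\<forall>\<phi> :: nat \<Rightarrow> 'b multiset. (\<Sum>(n, x)\<in>#M'. \<phi> n) \<in> set_val (\<lambda>n. {\<phi> n}) t"
    by blast
  then show ?case using uv(3) by (intro exI[of _ "M + M'"]) (auto intro!: set_plus_intro)
next
  case (Sum s t)
  from Sum.prems consider "w \<in> set_val \<rho> s" | "w \<in> set_val \<rho> t" by auto
  then show ?case
  proof cases
    case 1
    from Sum.IH(1)[OF this] show ?thesis by (elim ex_forward) auto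
  next
    case 2
    from Sum.IH(2)[OF this] show ?thesis by (elim ex_forward) auto
  qed
qed

section \<open>Syntactic semirings\<close>

text \<open>A Galois closure: \<open>w\<close> is added if every context \<open>c\<close> that sends
  all of \<open>X\<close> into \<open>L\<close> also sends \<open>w\<close> into \<open>L\<close>.
  As words commute, a context is a single word, possibly empty; \<open>w\<close> itself has to be
  nonempty because the signature has no unit.\<close>

definition syn_closure :: "'b multiset set \<Rightarrow> 'b multiset set \<Rightarrow> 'b multiset set" where
  "syn_closure L X = {w. w \<noteq> {#} \<and> (\<forall>c. (\<forall>x\<in>X. c + x \<in> L) \<longrightarrow> c + w \<in> L)}"

text \<open>The quotient of the semiring of nonempty sets of nonempty commutative words by the syntactic
  congruence of \<open>L\<close>, each class being represented by its largest element.\<close>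

definition syn_semiring :: "'b multiset set \<Rightarrow> 'b multiset set ai_semiring" where
  "syn_semiring L =
     \<lparr>carrier = {X. X \<noteq> {} \<and> {#} \<notin> X \<and> syn_closure L X = X},
      plus_op = (\<lambda>X Y. syn_closure L (X \<union> Y)),
      times_op = (\<lambda>X Y. syn_closure L (X + Y))\<rparr>"

lemma syn_closure_least:
  assumes "X \<subseteq> syn_closure L Y"
  shows "syn_closure L X \<subseteq> syn_closure L Y"
  using assms unfolding syn_closure_def by blast

lemma syn_closure_increasing: "{#} \<notin> X \<Longrightarrow> X \<subseteq> syn_closure L X"
  by (auto simp: syn_closure_def)

lemma empty_notin_syn_closure [simp]: "{#} \<notin> syn_closure L X"
  by (simp add: syn_closure_def)

lemma syn_closure_idem [simp]: "syn_closure L (syn_closure L X) = syn_closure L X"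
  using syn_closure_least[OF order_refl] syn_closure_increasing[OF empty_notin_syn_closure]
  by (rule equalityI)

lemma syn_closure_mono: "X \<subseteq> Y \<Longrightarrow> syn_closure L X \<subseteq> syn_closure L Y"
  unfolding syn_closure_def by blast

text \<open>The factors are exchanged one at a time: \<open>c + y\<close> with
  \<open>y \<in> Y\<close> is a context for \<open>X\<close>, and afterwards \<open>c + w\<close> is
  a context for \<open>Y\<close>.\<close>

lemma syn_closure_plus_subset: "syn_closure L X + syn_closure L Y \<subseteq> syn_closure L (X + Y)"
proof
  fix z assume "z \<in> syn_closure L X + syn_closure L Y"
  then obtain w w' where w: "w \<in> syn_closure L X" "w' \<in> syn_closure L Y" "z = w + w'"
    by (auto simp: set_plus_def)
  have "c + (w + w') \<in> L" if c: "\<forall>x\<in>X + Y. c + x \<in> L" for c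
  proof -
    have "(c + y) + w \<in> L" if "y \<in> Y" for y
      using w(1) c that by (force simp: syn_closure_def set_plus_def ac_simps)
    then have "(c + w) + w' \<in> L" using w(2) by (force simp: syn_closure_def ac_simps)
    then show ?thesis by (simp add: ac_simps)
  qed
  then show "z \<in> syn_closure L (X + Y)" using w by (auto simp: syn_closure_def)
qed

lemma empty_notin_set_plus: "{#} \<notin> X \<Longrightarrow> {#} \<notin> X + Y" for X :: "'b multiset set"
  by (auto simp: set_plus_def)

lemma syn_closure_Un:
  assumes "{#} \<notin> X" "{#} \<notin> Y"
  shows "syn_closure L (syn_closure L X \<union> syn_closure L Y) = syn_closure L (X \<union> Y)"
proof (rule equalityI)
  have "syn_closure L X \<union> syn_closure L Y \<subseteq> syn_closure L (X \<union> Y)"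
    using syn_closure_mono[of X "X \<union> Y" L] syn_closure_mono[of Y "X \<union> Y" L] by blast
  then show "syn_closure L (syn_closure L X \<union> syn_closure L Y) \<subseteq> syn_closure L (X \<union> Y)"
    by (rule syn_closure_least)
  show "syn_closure L (X \<union> Y) \<subseteq> syn_closure L (syn_closure L X \<union> syn_closure L Y)"
    using assms by (rule syn_closure_mono[OF Un_mono[OF syn_closure_increasing syn_closure_increasing]])
qed

lemma syn_closure_plus:
  assumes "{#} \<notin> X" "{#} \<notin> Y"
  shows "syn_closure L (syn_closure L X + syn_closure L Y) = syn_closure L (X + Y)"
proof (rule equalityI)
  show "syn_closure L (syn_closure L X + syn_closure L Y) \<subseteq> syn_closure L (X + Y)"
    by (rule syn_closure_least[OF syn_closure_plus_subset])
  show "syn_closure L (X + Y) \<subseteq> syn_closure L (syn_closure L X + syn_closure L Y)"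
    using assms
    by (rule syn_closure_mono[OF set_plus_mono2[OF syn_closure_increasing syn_closure_increasing]])
qed

lemma is_ai_semiring_syn_semiring: "is_ai_semiring (syn_semiring (L :: 'b multiset set))"
proof -
  let ?C = "carrier (syn_semiring L)"
  have C: "X \<in> ?C \<longleftrightarrow> X \<noteq> {} \<and> {#} \<notin> X \<and> syn_closure L X = X" for X
    by (simp add: syn_semiring_def)
  have clC: "syn_closure L X \<in> ?C" if "X \<noteq> {}" "{#} \<notin> X" for X
    using that syn_closure_increasing[of X L] by (auto simp: C)
  have ne: "X + Y \<noteq> {}" if "X \<noteq> {}" "Y \<noteq> {}" for X Y :: "'b multiset set"
    using that by (auto simp: set_plus_def)
  have Un1: "syn_closure L (syn_closure L X \<union> Z) = syn_closure L (X \<union> Z)"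
    "syn_closure L (Z \<union> syn_closure L X) = syn_closure L (Z \<union> X)"
    if "{#} \<notin> X" "Z \<in> ?C" for X Z
    using syn_closure_Un[of X Z L] syn_closure_Un[of Z X L] that by (auto simp: C)
  have plus1: "syn_closure L (syn_closure L X + Z) = syn_closure L (X + Z)"
    "syn_closure L (Z + syn_closure L X) = syn_closure L (Z + X)"
    if "{#} \<notin> X" "Z \<in> ?C" for X Z
    using syn_closure_plus[of X Z L] syn_closure_plus[of Z X L] that by (auto simp: C)
  have n: "{#} \<notin> X + Y" "{#} \<notin> X" if "X \<in> ?C" for X Y
    using that empty_notin_set_plus[of X Y] by (auto simp: C)
  have dist: "Z + (X \<union> Y) = (Z + X) \<union> (Z + Y)" "(X \<union> Y) + Z = (X + Z) \<union> (Y + Z)"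
    for X Y Z :: "'b multiset set" by (auto simp: set_plus_def)
  have "is_ai_semiring (syn_semiring L) = (?C \<noteq> {} \<and>
     (\<forall>a\<in>?C. \<forall>b\<in>?C. syn_closure L (a \<union> b) \<in> ?C \<and> syn_closure L (a + b) \<in> ?C) \<and>
     (\<forall>a\<in>?C. \<forall>b\<in>?C. \<forall>c\<in>?C.
        syn_closure L (syn_closure L (a \<union> b) \<union> c) = syn_closure L (a \<union> syn_closure L (b \<union> c))) \<and>
     (\<forall>a\<in>?C. \<forall>b\<in>?C. syn_closure L (a \<union> b) = syn_closure L (b \<union> a)) \<and>
     (\<forall>a\<in>?C. syn_closure L (a \<union> a) = a) \<and>
     (\<forall>a\<in>?C. \<forall>b\<in>?C. \<forall>c\<in>?C.
        syn_closure L (syn_closure L (a + b) + c) = syn_closure L (a + syn_closure L (b + c))) \<and>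
     (\<forall>a\<in>?C. \<forall>b\<in>?C. \<forall>c\<in>?C. syn_closure L (a + syn_closure L (b \<union> c)) =
        syn_closure L (syn_closure L (a + b) \<union> syn_closure L (a + c))) \<and>
     (\<forall>a\<in>?C. \<forall>b\<in>?C. \<forall>c\<in>?C. syn_closure L (syn_closure L (a \<union> b) + c) =
        syn_closure L (syn_closure L (a + c) \<union> syn_closure L (b + c))))"
    by (simp add: is_ai_semiring_def syn_semiring_def)
  also have \<dots>
  proof (intro conjI ballI)
    show "?C \<noteq> {}" using clC[of "{{#undefined#}}"] by auto
    fix a b assume ab: "a \<in> ?C" "b \<in> ?C"
    show "syn_closure L (a \<union> b) \<in> ?C" using ab by (intro clC) (auto simp: C)
    show "syn_closure L (a + b) \<in> ?C" using ab by (intro clC ne n) (auto simp: C)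
    show "syn_closure L (a \<union> b) = syn_closure L (b \<union> a)" by (simp add: Un_commute)
    fix c assume c: "c \<in> ?C"
    show "syn_closure L (syn_closure L (a \<union> b) \<union> c) = syn_closure L (a \<union> syn_closure L (b \<union> c))"
      using ab c n by (simp add: Un1 Un_assoc)
    show "syn_closure L (syn_closure L (a + b) + c) = syn_closure L (a + syn_closure L (b + c))"
      using ab c n by (simp add: plus1 add.assoc)
    show "syn_closure L (a + syn_closure L (b \<union> c)) =
        syn_closure L (syn_closure L (a + b) \<union> syn_closure L (a + c))"
      using ab c n by (simp add: plus1 syn_closure_Un dist)
    show "syn_closure L (syn_closure L (a \<union> b) + c) =
        syn_closure L (syn_closure L (a + c) \<union> syn_closure L (b + c))"
      using ab c n by (simp add: plus1 syn_closure_Un dist)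
  qed (simp add: C)
  finally show ?thesis .
qed

lemma empty_notin_set_val:
  fixes \<rho> :: "nat \<Rightarrow> 'b multiset set"
  assumes "\<And>n. {#} \<notin> \<rho> n"
  shows "{#} \<notin> set_val \<rho> t"
  using assms by (induction t) (auto simp: empty_notin_set_plus)

text \<open>The closure is a homomorphism on sets of nonempty words, so it may be taken once at the
  end.\<close>

lemma term_val_syn_semiring:
  assumes "\<And>n. {#} \<notin> \<rho> n"
  shows "term_val (syn_semiring L) (\<lambda>n. syn_closure L (\<rho> n)) t = syn_closure L (set_val \<rho> t)"
  using empty_notin_set_val[OF assms]
  by (induction t) (auto simp: syn_semiring_def syn_closure_Un syn_closure_plus)

section \<open>Identities of power semirings of groups with at least three elements\<close>

lemma UNIV_plus:
  fixes X :: "'a::ab_group_add set"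
  assumes "X \<noteq> {}"
  shows "UNIV + X = UNIV" "X + UNIV = UNIV"
proof -
  obtain x where "x \<in> X" using assms by blast
  then have "z \<in> UNIV + X" for z using diff_add_cancel[of z x] by (metis UNIV_I set_plus_intro)
  then show "UNIV + X = UNIV" by auto
  then show "X + UNIV = UNIV" by (simp add: add.commute)
qed

text \<open>The commutative subgroup with at least three elements that every group of order at least three
  contains is presented as a homomorphic image, so that sums of multisets can be used for products.\<close>

locale large_hom =
  fixes H :: "('h, 'm) monoid_scheme" and \<theta> :: "'a::ab_group_add \<Rightarrow> 'h"
  assumes closed: "\<theta> x \<in> carrier H"
    and hom: "\<theta> (x + y) = \<theta> x \<otimes>\<^bsub>H\<^esub> \<theta> y"
    and large: "\<exists>z. \<theta> z \<noteq> \<theta> x \<and> \<theta> z \<noteq> \<theta> y"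
begin

lemma shift: "\<theta> (x + z) = \<theta> (y + z) \<longleftrightarrow> \<theta> x = \<theta> y"
proof -
  have "\<theta> x = \<theta> y" if "\<theta> (x + z) = \<theta> (y + z)"
    using that hom[of "x + z" "- z"] hom[of "y + z" "- z"] by simp
  then show ?thesis by (auto simp: hom)
qed

lemma diff_zero: "\<theta> (x - y) = \<theta> 0 \<longleftrightarrow> \<theta> x = \<theta> y"
  using shift[of "x - y" y 0] by simp

lemma minus_zero: "\<theta> (- x) = \<theta> 0 \<longleftrightarrow> \<theta> x = \<theta> 0"
  using shift[of "- x" x 0] by auto

lemma term_val_power_semiring:
  assumes "\<And>v w. E (v + w) = E v + E w"
  shows "term_val (power_semiring H) (\<lambda>n. \<theta> ` E (\<phi> n)) t
    = \<theta> ` (\<Union>w\<in>set_val (\<lambda>n. {\<phi> n}) t. E w)"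
proof (induction t)
  case (Prod s t)
  have "set_mult H (\<theta> ` X) (\<theta> ` Y) = \<theta> ` (X + Y)" for X Y
    by (force simp: set_mult_def set_plus_def hom image_iff)
  moreover have "(\<Union>w\<in>V. E w) + (\<Union>w\<in>W. E w) = (\<Union>w\<in>V + W. E w)" for V W
    using assms by (fastforce simp: set_plus_def)
  ultimately show ?case using Prod by (simp add: power_semiring_def)
qed (auto simp: power_semiring_def)

text \<open>This is how identities of \<open>power_semiring H\<close> are exploited: every
  homomorphism \<open>E\<close> from words to nonempty sets provides a substitution that tests
  them.\<close>

lemma satisfiesD:
  assumes "satisfies (power_semiring H) (p, q)"
    and "\<And>v w. E (v + w) = E v + E w" "\<And>w. E w \<noteq> {}"
    and "w \<in> set_val (\<lambda>n. {\<phi> n}) p" "x \<in> E w"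
  obtains w' y where "w' \<in> set_val (\<lambda>n. {\<phi> n}) q" "y \<in> E w'" "\<theta> y = \<theta> x"
proof -
  have "\<forall>n. \<theta> ` E (\<phi> n) \<in> carrier (power_semiring H)"
    using assms(3) closed by (auto simp: power_semiring_def)
  then have "term_val (power_semiring H) (\<lambda>n. \<theta> ` E (\<phi> n)) p
      = term_val (power_semiring H) (\<lambda>n. \<theta> ` E (\<phi> n)) q"
    using assms(1) unfolding satisfies_def by auto
  then have "\<theta> ` (\<Union>w\<in>set_val (\<lambda>n. {\<phi> n}) p. E w) = \<theta> ` (\<Union>w\<in>set_val (\<lambda>n. {\<phi> n}) q. E w)"
    by (simp only: term_val_power_semiring[of E, OF assms(2)])
  moreover have "\<theta> x \<in> \<theta> ` (\<Union>w\<in>set_val (\<lambda>n. {\<phi> n}) p. E w)" using assms(4,5) by auto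
  ultimately have "\<theta> x \<in> \<theta> ` (\<Union>w\<in>set_val (\<lambda>n. {\<phi> n}) q. E w)" by simp
  then show ?thesis using that by fastforce
qed

text \<open>Substitute an absorbing set, the image of \<open>UNIV\<close>, for \<open>v\<close> and
  the neutral element for all other variables. Words over \<open>bool\<close> suffice, with
  \<open>True\<close> marking \<open>v\<close>.\<close>

lemma satisfies_vars:
  assumes "satisfies (power_semiring H) (p, q)"
  shows "term_vars p \<subseteq> term_vars q"
proof (rule ccontr)
  assume "\<not> term_vars p \<subseteq> term_vars q"
  then obtain v where v: "v \<in> term_vars p" "v \<notin> term_vars q" by auto
  define \<phi> where "\<phi> n = {#n = v#}" for n
  define E :: "bool multiset \<Rightarrow> 'a set" where "E w = (if True \<in># w then UNIV else {0})" for w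
  have E: "E (u + w) = E u + E w" "E w \<noteq> {}" for u w
    by (auto simp: E_def UNIV_plus)
  obtain w where w: "w \<in> set_val (\<lambda>n. {\<phi> n}) p" "\<phi> v \<subseteq># w"
    using set_val_singleton_var[OF v(1)] by blast
  obtain x where x: "\<theta> x \<noteq> \<theta> 0" using large by blast
  have "x \<in> E w" using w(2) by (auto simp: E_def \<phi>_def)
  obtain w' y where y: "w' \<in> set_val (\<lambda>n. {\<phi> n}) q" "y \<in> E w'" "\<theta> y = \<theta> x"
    using satisfiesD[OF assms E w(1) \<open>x \<in> E w\<close>] by blast
  obtain M where "set_mset M \<subseteq> term_vars q" "w' = (\<Sum>n\<in>#M. \<phi> n)"
    using set_val_singletonD[OF y(1)] by blast
  then have "True \<notin># w'" using v by (auto simp: \<phi>_def in_Union_mset_iff)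
  then show False using x y by (simp add: E_def)
qed

text \<open>The complement \<open>B\<close> of a point satisfies \<open>B + B = UNIV\<close>. Substituting it for the letter \<open>v\<close> and
  zero for all other letters distinguishes words containing \<open>v\<close> at most once from the others.\<close>

lemma satisfies_linear:
  assumes sat: "satisfies (power_semiring H) (p, q)"
    and q: "\<And>w. w \<in> set_val (\<lambda>n. {\<phi> n}) q \<Longrightarrow> count w v \<le> 1"
    and w: "w \<in> set_val (\<lambda>n. {\<phi> n}) p"
  shows "count w v \<le> 1"
proof (rule ccontr)
  assume two: "\<not> count w v \<le> 1"
  obtain h where h: "\<theta> h \<noteq> \<theta> 0" using large by blast
  define B where "B = {b. \<theta> b \<noteq> \<theta> h}"
  have "z \<in> B + B" for z
  proof -
    \<comment> \<open>The two values avoided by \<open>b\<close> ensure that both \<open>b\<close>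
      and \<open>z - b\<close> lie in \<open>B\<close>.\<close>
    obtain b where b: "\<theta> b \<noteq> \<theta> h" "\<theta> b \<noteq> \<theta> (z - h)" using large by blast
    have "\<theta> (z - b) \<noteq> \<theta> h"
      using shift[of "z - b" "b - h" h] b by (auto simp: algebra_simps)
    then have "b + (z - b) \<in> B + B" using b by (intro set_plus_intro) (auto simp: B_def)
    then show ?thesis by simp
  qed
  then have BB: "B + B = UNIV" by auto
  have "0 \<in> B" using h by (simp add: B_def)
  \<comment> \<open>\<open>f n\<close> is the \<open>n\<close>-fold sum of \<open>B\<close>, which
    is already everything for \<open>n = 2\<close>.\<close>
  define f where "f n = (if n = 0 then {0} else if n = 1 then B else UNIV)" for n :: nat
  have ne: "f n \<noteq> {}" for n using \<open>0 \<in> B\<close> by (auto simp: f_def)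
  have zero: "{0} + X = X" "X + {0} = X" for X :: "'a set" by (auto simp: set_plus_def)
  have f_add: "f (m + n) = f m + f n" for m n
  proof -
    have "B \<noteq> {}" using \<open>0 \<in> B\<close> by auto
    consider "m = 0" | "n = 0" | "m = 1" "n = 1" | "m \<ge> 1" "n \<ge> 2" | "m \<ge> 2" "n \<ge> 1" by linarith
    then show ?thesis
      by cases (simp_all add: f_def zero BB UNIV_plus \<open>B \<noteq> {}\<close>)
  qed
  have "h \<in> f (count w v)" using two by (simp add: f_def)
  then obtain w' y where "w' \<in> set_val (\<lambda>n. {\<phi> n}) q" "y \<in> f (count w' v)" "\<theta> y = \<theta> h"
    using satisfiesD[OF sat, of "\<lambda>w. f (count w v)" w \<phi> h] w ne f_add by (auto simp del: count_eq_zero_iff)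
  then show False using q[of w'] h by (auto simp: f_def B_def le_Suc_eq split: if_splits)
qed

end

text \<open>The letter values for which the prefix ending at letter \<open>u\<close> evaluates to
  \<open>\<pi> u\<close>, so that a colouring of the vertices becomes a substitution for the
  letters.\<close>

definition increment :: "(nat \<Rightarrow> 'a::ab_group_add) \<Rightarrow> nat \<Rightarrow> 'a" where
  "increment \<pi> u = (case u of 0 \<Rightarrow> \<pi> 0 | Suc v \<Rightarrow> \<pi> u - \<pi> v)"

lemma sum_increment: "i \<le> j \<Longrightarrow> sum (increment \<pi>) {i<..j} = \<pi> j - \<pi> i"
proof (induction j rule: dec_induct)
  case (step j)
  have "{i<..Suc j} = insert (Suc j) {i<..j}" using step by auto
  then show ?case using step by (simp add: increment_def)
qed simp

text \<open>The contribution of vertex \<open>u\<close> after summation by parts over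
  \<open>D\<close>. It is nonzero only if exactly one of \<open>u\<close> and \<open>Suc u\<close>
  lies in \<open>D\<close>; for \<open>D = {i<..j}\<close> the contributions add up to
  \<open>\<pi> j - \<pi> i\<close>.\<close>

definition boundary :: "nat set \<Rightarrow> nat \<Rightarrow> 'a::ab_group_add \<Rightarrow> 'a" where
  "boundary D u x = (if u \<in> D \<and> Suc u \<notin> D then x else if u \<notin> D \<and> Suc u \<in> D then - x else 0)"

lemma sum_increment_boundary:
  assumes "D \<subseteq> {..N}"
  shows "sum (increment \<pi>) D = (\<Sum>u\<le>N. boundary D u (\<pi> u))"
proof -
  \<comment> \<open>The correction term compensates for letter \<open>Suc M\<close>, which the
    boundary at \<open>M\<close> already takes into account. It vanishes for
    \<open>M = N\<close>.\<close>
  have "(\<Sum>u\<le>M. if u \<in> D then increment \<pi> u else 0)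
      = (\<Sum>u\<le>M. boundary D u (\<pi> u)) + (if Suc M \<in> D then \<pi> M else 0)" for M
    by (induction M) (auto simp: boundary_def increment_def)
  from this[of N] have "(\<Sum>u\<in>{..N} \<inter> D. increment \<pi> u) = (\<Sum>u\<le>N. boundary D u (\<pi> u))"
    using assms by (auto simp: sum.inter_restrict)
  moreover have "{..N} \<inter> D = D" using assms by auto
  ultimately show ?thesis by simp
qed

section \<open>Recognising the interval of an arc by means of colourings\<close>

context large_hom
begin

text \<open>If the boundary of \<open>D\<close> has two points on the same side of the bipartition, their colours can be
  chosen freely among the nonzero elements when the other side is coloured by zero, and any element is
  a sum of two such colours. So the boundary has one point on each side.\<close>

lemma interval_if_colourings:
  fixes F :: "(nat \<times> nat) set" and \<chi> :: "nat \<Rightarrow> bool"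
  assumes D: "D \<subseteq> {..N}"
    and F: "\<And>i j. (i, j) \<in> F \<Longrightarrow> i < j"
    and \<chi>: "\<And>i j. (i, j) \<in> F \<Longrightarrow> \<chi> i \<noteq> \<chi> j"
    and ex: "\<And>\<pi> :: nat \<Rightarrow> 'a. \<exists>(i, j)\<in>F. \<theta> (sum (increment \<pi>) D) = \<theta> (\<pi> j - \<pi> i)"
  shows "\<exists>(i, j)\<in>F. D = {i<..j}"
proof -
  \<comment> \<open>A colouring for which the sum over \<open>D\<close> vanishes cannot be proper.
    Each of the contradictions below comes from a proper colouring with vanishing sum.\<close>
  have improper: "\<exists>(i, j)\<in>F. \<theta> (\<pi> i) = \<theta> (\<pi> j)" if z: "sum (increment \<pi>) D = 0" for \<pi> :: "nat \<Rightarrow> 'a"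
  proof -
    obtain i j where "(i, j) \<in> F" "\<theta> 0 = \<theta> (\<pi> j - \<pi> i)" using ex[of \<pi>] unfolding z by auto
    then show ?thesis using diff_zero[of "\<pi> j" "\<pi> i"] by (intro bexI[of _ "(i, j)"]) auto
  qed
  have improper': "\<exists>(i, j)\<in>F. \<theta> (\<pi> i) = \<theta> (\<pi> j)" if "(\<Sum>u\<le>N. boundary D u (\<pi> u)) = 0"
    for \<pi> :: "nat \<Rightarrow> 'a"
    by (rule improper) (simp only: sum_increment_boundary[OF D] that)
  obtain e where e: "\<theta> e \<noteq> \<theta> 0" using large by blast
  define P where "P u \<longleftrightarrow> u \<le> N \<and> (u \<in> D) \<noteq> (Suc u \<in> D)" for u
  have diff_side: "\<chi> a \<noteq> \<chi> b" if ab: "P a" "P b" "a \<noteq> b" for a b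
  proof
    assume side: "\<chi> a = \<chi> b"
    define \<pi>\<^sub>0 where "\<pi>\<^sub>0 u = (if \<chi> u = \<chi> a then e else 0)" for u
    define R where "R = (\<Sum>u\<in>{..N} - {a} - {b}. boundary D u (\<pi>\<^sub>0 u))"
    \<comment> \<open>The colour \<open>t\<close> of \<open>b\<close> is forced by the requirement
      that the total vanishes. The second value avoided by \<open>s\<close> is the one that would
      make \<open>t\<close> trivial.\<close>
    obtain s where s: "\<theta> s \<noteq> \<theta> 0" "\<theta> s \<noteq> \<theta> (boundary D a (- R))" using large by blast
    define t where "t = boundary D b (- R - boundary D a s)"
    have inv: "boundary D b t = - R - boundary D a s"
      using ab by (auto simp: t_def P_def boundary_def)
    have "\<theta> (- R - boundary D a s) \<noteq> \<theta> 0"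
      using s(2) ab(1) diff_zero[of "- R" s] diff_zero[of s R]
      by (auto simp: P_def boundary_def algebra_simps)
    then have t: "\<theta> t \<noteq> \<theta> 0"
      using ab(2) minus_zero[of "- R - boundary D a s"] by (auto simp: t_def P_def boundary_def)
    define \<pi> where "\<pi> = \<pi>\<^sub>0(a := s, b := t)"
    have "(\<Sum>u\<le>N. boundary D u (\<pi> u)) = boundary D a s + (boundary D b t + R)"
    proof -
      have "(\<Sum>u\<in>{..N} - {a} - {b}. boundary D u (\<pi> u)) = R"
        unfolding R_def by (rule sum.cong) (auto simp: \<pi>_def)
      then show ?thesis using ab
        by (simp add: sum.remove[of "{..N}" a] sum.remove[of "{..N} - {a}" b] P_def \<pi>_def)
    qed
    then have "(\<Sum>u\<le>N. boundary D u (\<pi> u)) = 0" using inv by simp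
    from improper'[OF this] obtain i j where ij: "(i, j) \<in> F" "\<theta> (\<pi> i) = \<theta> (\<pi> j)" by auto
    then show False using \<chi>[OF ij(1)] side e s(1) t ab(3)
      by (auto simp: \<pi>_def \<pi>\<^sub>0_def split: if_splits)
  qed
  have "D \<noteq> {}"
  proof
    assume "D = {}"
    then obtain i j where "(i, j) \<in> F" "\<theta> (if \<chi> i then e else 0) = \<theta> (if \<chi> j then e else 0)"
      using improper[of "\<lambda>u. if \<chi> u then e else 0"] by auto
    then show False using \<chi>[of i j] e by (auto split: if_splits)
  qed
  have finD: "finite D" using D finite_subset by blast
  define b where "b = Max D"
  have b: "b \<in> D" "\<And>u. u \<in> D \<Longrightarrow> u \<le> b"
    using finD \<open>D \<noteq> {}\<close> by (auto simp: b_def)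
  have Pb: "P b" using b(1) b(2)[of "Suc b"] D by (auto simp: P_def)
  \<comment> \<open>An initial segment has \<open>b\<close> as its only boundary point, so colouring
    the side of \<open>b\<close> by zero makes the sum vanish.\<close>
  have "{u. u < b \<and> u \<notin> D} \<noteq> {}"
  proof
    assume "{u. u < b \<and> u \<notin> D} = {}"
    then have "u \<in> D \<longleftrightarrow> u \<le> b" for u using b by (cases "u = b") (auto simp: le_less)
    then have "D = {..b}" by auto
    let ?\<pi> = "\<lambda>u. if \<chi> u = \<chi> b then 0 else e"
    have "(\<Sum>u\<le>N. boundary D u (?\<pi> u)) = 0"
      by (rule sum.neutral) (auto simp: boundary_def \<open>D = {..b}\<close> not_less_eq_eq le_Suc_eq)
    from improper'[OF this] obtain i j where "(i, j) \<in> F" "\<theta> (?\<pi> i) = \<theta> (?\<pi> j)" by auto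
    then show False using \<chi>[of i j] e by (auto split: if_splits)
  qed
  moreover define a where "a = Max {u. u < b \<and> u \<notin> D}"
  ultimately have "a \<in> {u. u < b \<and> u \<notin> D}" and amax: "\<And>u. u < b \<Longrightarrow> u \<notin> D \<Longrightarrow> u \<le> a"
    using Max_in[of "{u. u < b \<and> u \<notin> D}"] Max_ge[of "{u. u < b \<and> u \<notin> D}"] by auto
  then have a: "a < b" "a \<notin> D" by auto
  have above: "u \<in> D" if "a < u" "u \<le> b" for u
    using amax[of u] b(1) that by (cases "u = b") force+
  have Pa: "P a" using a above[of "Suc a"] b D by (auto simp: P_def)
  have below: "u \<notin> D" if "u < a" for u
  proof
    assume "u \<in> D"
    \<comment> \<open>An element of \<open>D\<close> below \<open>a\<close> leads to a third
      boundary point \<open>a'\<close>, and two of three boundary points lie on the same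
      side.\<close>
    define a' where "a' = Max {u \<in> D. u < a}"
    have "a' \<in> {u \<in> D. u < a}" unfolding a'_def using that \<open>u \<in> D\<close> finD by (intro Max_in) auto
    moreover have "u \<le> a'" if "u \<in> D" "u < a" for u
      unfolding a'_def using that finD by (intro Max_ge) auto
    ultimately have a': "a' < a" "a' \<in> D" "Suc a' \<notin> D"
      using a(2) by (auto intro: Suc_lessI) (metis Suc_lessI Suc_n_not_le_n)
    then have "P a'" using D by (auto simp: P_def)
    then show False using diff_side[OF Pa Pb] diff_side[OF \<open>P a'\<close> Pb] diff_side[OF \<open>P a'\<close> Pa] a a'(1)
      by auto
  qed
  have D_eq: "D = {a<..b}"
  proof (intro equalityI subsetI)
    fix u assume "u \<in> D"
    then show "u \<in> {a<..b}" using b(2) below[of u] a(2) by (cases u a rule: linorder_cases) auto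
  qed (use above in auto)
  have "(a, b) \<in> F"
  proof (rule ccontr)
    assume notF: "(a, b) \<notin> F"
    \<comment> \<open>Giving a third colour to both \<open>a\<close> and \<open>b\<close> makes the
      sum over \<open>{a<..b}\<close> vanish, and only an arc \<open>(a, b)\<close> could become
      monochromatic.\<close>
    obtain f where f: "\<theta> f \<noteq> \<theta> 0" "\<theta> f \<noteq> \<theta> e" using large by blast
    let ?\<pi> = "\<lambda>u. if u = a \<or> u = b then f else if \<chi> u then e else 0"
    have "sum (increment ?\<pi>) D = 0" using a by (simp add: D_eq sum_increment)
    from improper[OF this] obtain i j where ij: "(i, j) \<in> F" "\<theta> (?\<pi> i) = \<theta> (?\<pi> j)" by auto
    then show False using \<chi>[OF ij(1)] F[OF ij(1)] notF a(1) e f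
      by (auto split: if_splits)
  qed
  then show ?thesis using D_eq by auto
qed

end

text \<open>If some \<open>g\<close> has a nontrivial square, then the unit, \<open>g\<close> and
  its square are distinct and powers of \<open>g\<close> suffice. Otherwise all elements are
  involutions or trivial, so \<open>H\<close> is commutative, and two distinct nontrivial elements
  generate a large enough subgroup. The domain \<open>int \<times> int\<close> serves both
  cases.\<close>

lemma ex_large_hom:
  assumes "group H" "finite (carrier H)" "order H \<ge> 3"
  shows "\<exists>\<theta> :: int \<times> int \<Rightarrow> 'h. large_hom (H :: ('h, 'm) monoid_scheme) \<theta>"
proof -
  interpret group H by fact
  have three: "\<exists>z. \<theta> z \<noteq> \<theta> x \<and> \<theta> z \<noteq> \<theta> y"
    if "\<theta> u \<noteq> \<theta> v" "\<theta> u \<noteq> \<theta> w" "\<theta> v \<noteq> \<theta> w" for \<theta> :: "int \<times> int \<Rightarrow> 'h" and u v w x y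
    using that by metis
  show ?thesis
  proof (cases "\<exists>g\<in>carrier H. g \<otimes>\<^bsub>H\<^esub> g \<noteq> \<one>\<^bsub>H\<^esub>")
    case True
    then obtain g where g: "g \<in> carrier H" "g \<otimes>\<^bsub>H\<^esub> g \<noteq> \<one>\<^bsub>H\<^esub>" by blast
    define \<theta> where "\<theta> = (\<lambda>(a :: int, b :: int). g [^]\<^bsub>H\<^esub> a)"
    have v: "\<theta> (0, 0) = \<one>\<^bsub>H\<^esub>" "\<theta> (1, 0) = g" "\<theta> (2, 0) = g \<otimes>\<^bsub>H\<^esub> g"
      using g int_pow_mult[OF g(1), of 1 1] by (auto simp: \<theta>_def int_pow_1)
    have "g \<noteq> \<one>\<^bsub>H\<^esub>" "g \<noteq> g \<otimes>\<^bsub>H\<^esub> g" using g by auto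
    then have "large_hom H \<theta>"
      using g three[of \<theta> "(0, 0)" "(1, 0)" "(2, 0)"] unfolding v
      by unfold_locales (auto simp: \<theta>_def int_pow_mult)
    then show ?thesis by blast
  next
    case False
    interpret comm_group H
    proof (rule group_comm_groupI)
      fix x y assume xy: "x \<in> carrier H" "y \<in> carrier H"
      have inv: "inv\<^bsub>H\<^esub> z = z" if "z \<in> carrier H" for z using False that by (intro inv_equality) auto
      show "x \<otimes>\<^bsub>H\<^esub> y = y \<otimes>\<^bsub>H\<^esub> x" using inv_mult_group[OF xy] inv xy by simp
    qed
    have large: "\<not> carrier H \<subseteq> {a, b}" for a b
    proof
      assume "carrier H \<subseteq> {a, b}"
      then have "card (carrier H) \<le> card {a, b}" by (intro card_mono) auto
      also have "\<dots> \<le> 2" by (simp add: card_insert_if)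
      finally show False using assms(3) by (simp add: order_def)
    qed
    obtain g where g: "g \<in> carrier H" "g \<noteq> \<one>\<^bsub>H\<^esub>" using large[of "\<one>\<^bsub>H\<^esub>" "\<one>\<^bsub>H\<^esub>"] by auto
    obtain h where h: "h \<in> carrier H" "h \<noteq> \<one>\<^bsub>H\<^esub>" "h \<noteq> g" using large[of "\<one>\<^bsub>H\<^esub>" g] by auto
    define \<theta> where "\<theta> = (\<lambda>(a :: int, b :: int). g [^]\<^bsub>H\<^esub> a \<otimes>\<^bsub>H\<^esub> h [^]\<^bsub>H\<^esub> b)"
    have v: "\<theta> (0, 0) = \<one>\<^bsub>H\<^esub>" "\<theta> (1, 0) = g" "\<theta> (0, 1) = h"
      using g h by (auto simp: \<theta>_def int_pow_1)
    have "large_hom H \<theta>"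
      using g h three[of \<theta> "(0, 0)" "(1, 0)" "(0, 1)"] unfolding v
      by unfold_locales (auto simp: \<theta>_def int_pow_mult m_ac)
    then show ?thesis by blast
  qed
qed

section \<open>The semiring of a digraph\<close>

lemma finite_term_vars [simp]: "finite (term_vars t)"
  by (induction t) auto

lemma set_val_mono: "(\<And>n. \<rho> n \<subseteq> \<rho>' n) \<Longrightarrow> set_val \<rho> t \<subseteq> set_val \<rho>' t"
  by (induction t) (auto intro: set_plus_mono2[THEN subsetD])

lemma set_val_nonempty: "(\<And>n. \<rho> n \<noteq> {}) \<Longrightarrow> set_val \<rho> t \<noteq> {}"
  by (induction t) (auto simp: set_plus_def)

text \<open>Vertex \<open>i\<close> of the digraph stands for the prefix \<open>x\<^sub>0 \<dots> x\<^sub>i\<close>, so the arc \<open>(i, j)\<close> deletes the letters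
  with indices in \<open>{i<..j}\<close>. The letter \<open>x\<^sub>0\<close> is never deleted.\<close>

definition arc_words :: "nat \<Rightarrow> (nat \<times> nat) set \<Rightarrow> nat multiset set" where
  "arc_words N E = {mset_set ({..N} - {i<..j}) | i j. (i, j) \<in> E}"

lemma arc_words_count_le: "w \<in> arc_words N E \<Longrightarrow> count w v \<le> 1"
  by (auto simp: arc_words_def count_mset_set')

lemma arc_words_letter_le: "w \<in> arc_words N E \<Longrightarrow> v \<in># w \<Longrightarrow> v \<le> N"
  by (auto simp: arc_words_def)

lemma mset_set_set_mset_squarefree:
  assumes "\<And>v. count w v \<le> 1"
  shows "mset_set (set_mset w) = w"
proof (rule multiset_eqI)
  fix v
  show "count (mset_set (set_mset w)) v = count w v"
    using assms[of v] by (auto simp: count_mset_set' not_in_iff le_Suc_eq simp flip: count_greater_zero_iff)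
qed

text \<open>A variable used twice contributes each letter of its nonempty word twice.\<close>

lemma squarefree_sum_unique:
  fixes \<phi> :: "nat \<Rightarrow> nat multiset"
  assumes sq: "\<And>v. count (\<Sum>(n, x)\<in>#M. \<phi> n) v \<le> 1" and ne: "\<And>n. \<phi> n \<noteq> {#}"
    and "(n, x) \<in># M" "(n, y) \<in># M - {#(n, x)#}"
  shows False
proof -
  obtain M' where "M = add_mset (n, x) (add_mset (n, y) M')"
    using assms(3,4) by (metis insert_DiffM)
  moreover obtain v where "v \<in># \<phi> n" using ne[of n] by auto
  ultimately show False using sq[of v] by (simp add: not_in_iff[symmetric] flip: count_greater_zero_iff)
qed

text \<open>A monomial with a squarefree value uses each variable at most once, so it is given by a
  set of variables.\<close>

lemma card_set_val_squarefree:
  fixes \<phi> :: "nat \<Rightarrow> nat multiset"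
  assumes ne: "\<And>n. \<phi> n \<noteq> {#}"
    and sq: "\<And>w v. w \<in> set_val (\<lambda>n. {\<phi> n}) t \<Longrightarrow> count w v \<le> 1"
  shows "finite (set_val (\<lambda>n. {\<phi> n}) t)" "card (set_val (\<lambda>n. {\<phi> n}) t) \<le> 2 ^ card (term_vars t)"
proof -
  have sub: "set_val (\<lambda>n. {\<phi> n}) t \<subseteq> sum \<phi> ` Pow (term_vars t)"
  proof
    fix w assume w: "w \<in> set_val (\<lambda>n. {\<phi> n}) t"
    obtain M where M: "set_mset M \<subseteq> term_vars t" "w = (\<Sum>n\<in>#M. \<phi> n)"
      using set_val_singletonD[OF w] by blast
    have "count M n \<le> 1" for n
    proof (rule ccontr)
      assume "\<not> count M n \<le> 1"
      then have "n \<in># M - {#n#}" "n \<in># M"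
        by (auto simp flip: count_greater_zero_iff)
      then obtain M' where "M = add_mset n (add_mset n M')" by (metis insert_DiffM)
      moreover obtain v where "v \<in># \<phi> n" using ne[of n] by auto
      ultimately show False using sq[OF w, of v] M(2) by (simp flip: count_greater_zero_iff)
    qed
    then have "mset_set (set_mset M) = M" by (rule mset_set_set_mset_squarefree)
    then have "w = sum \<phi> (set_mset M)" using M(2) by (simp add: sum_unfold_sum_mset)
    then show "w \<in> sum \<phi> ` Pow (term_vars t)" using M(1) by blast
  qed
  show "finite (set_val (\<lambda>n. {\<phi> n}) t)" by (rule finite_subset[OF sub]) simp
  have "card (set_val (\<lambda>n. {\<phi> n}) t) \<le> card (sum \<phi> ` Pow (term_vars t))"
    by (rule card_mono[OF _ sub]) simp
  also have "\<dots> \<le> card (Pow (term_vars t))" by (rule card_image_le) simp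
  finally show "card (set_val (\<lambda>n. {\<phi> n}) t) \<le> 2 ^ card (term_vars t)" by (simp add: card_Pow)
qed

section \<open>Identities in few variables hold in the semiring of a locally bipartite
  digraph\<close>

context large_hom
begin

text \<open>Only the at most \<open>2 ^ k\<close> arcs whose words arise from \<open>q\<close>
  matter, and these form a bipartite graph. Substituting the increments of an arbitrary colouring,
  the identity makes the sum of the letters missing in \<open>c + w\<close> agree with the colour
  difference along one of these arcs. By \<open>interval_if_colourings\<close> the missing letters
  are those deleted by an arc.\<close>

lemma arc_words_singleton_closed:
  fixes \<phi> :: "nat \<Rightarrow> nat multiset"
  assumes E: "\<And>i j. (i, j) \<in> E \<Longrightarrow> i < j \<and> j \<le> N"
    and bip: "\<And>F. F \<subseteq> E \<Longrightarrow> card F \<le> 2 ^ k \<Longrightarrow> \<exists>\<chi> :: nat \<Rightarrow> bool. \<forall>(i, j)\<in>F. \<chi> i \<noteq> \<chi> j"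
    and sat: "satisfies (power_semiring H) (p, q)"
    and k: "card (term_vars q) \<le> k"
    and ne: "\<And>n. \<phi> n \<noteq> {#}"
    and q: "\<And>x. x \<in> set_val (\<lambda>n. {\<phi> n}) q \<Longrightarrow> c + x \<in> arc_words N E"
    and w: "w \<in> set_val (\<lambda>n. {\<phi> n}) p"
  shows "c + w \<in> arc_words N E"
proof -
  let ?Q = "set_val (\<lambda>n. {\<phi> n}) q"
  have q_sq: "count c v + count x v \<le> 1" if "x \<in> ?Q" for x v
    using arc_words_count_le[OF q[OF that], of v] by simp
  have w_sq: "count w v \<le> 1" for v
    using satisfies_linear[OF sat _ w] q_sq by (meson le_add2 le_trans)
  obtain x\<^sub>0 where x\<^sub>0: "x\<^sub>0 \<in> ?Q" using set_val_nonempty[of "\<lambda>n. {\<phi> n}" q] by auto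
  \<comment> \<open>The variables of \<open>p\<close> occur in \<open>q\<close>, so every letter of
    \<open>w\<close> occurs in some \<open>x \<in> ?Q\<close>, and \<open>c + x\<close> is a
    squarefree word in letters up to \<open>N\<close>.\<close>
  have w_letters: "v \<le> N \<and> v \<notin># c" if v: "v \<in># w" for v
  proof -
    obtain M where M: "set_mset M \<subseteq> term_vars p" "w = (\<Sum>n\<in>#M. \<phi> n)"
      using set_val_singletonD[OF w] by blast
    then obtain n where n: "n \<in> term_vars p" "v \<in># \<phi> n" using v by (auto simp: in_Union_mset_iff)
    then obtain x where x: "x \<in> ?Q" "\<phi> n \<subseteq># x"
      using set_val_singleton_var satisfies_vars[OF sat] by blast
    have "v \<in># x" using mset_subset_eqD[OF x(2) n(2)] .
    then have "0 < count x v" by simp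
    then have "count c v = 0" using q_sq[OF x(1), of v] by linarith
    then show ?thesis using arc_words_letter_le[OF q[OF x(1)], of v] \<open>v \<in># x\<close> by (simp add: not_in_iff)
  qed
  define M where "M = set_mset (c + w)"
  have cw: "mset_set M = c + w" unfolding M_def
  proof (rule mset_set_set_mset_squarefree)
    fix v
    show "count (c + w) v \<le> 1"
      using q_sq[OF x\<^sub>0, of v] w_sq[of v] w_letters[of v] by (cases "v \<in># w") (auto simp: not_in_iff)
  qed
  have "v \<le> N" if "v \<in># c" for v
    using arc_words_letter_le[OF q[OF x\<^sub>0], of v] that by simp
  then have MN: "M \<subseteq> {..N}" using w_letters by (auto simp: M_def)
  \<comment> \<open>The arcs seen by \<open>q\<close>. Subtracting \<open>c\<close> maps them
    injectively into \<open>?Q\<close>, because distinct arcs delete distinct intervals.\<close>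
  define F where "F = {(i, j) \<in> E. \<exists>x\<in>?Q. c + x = mset_set ({..N} - {i<..j})}"
  have "card F \<le> card ?Q"
  proof (rule card_inj_on_le)
    show "finite ?Q"
      using q_sq by (intro card_set_val_squarefree(1) ne) (meson le_add2 le_trans)
    let ?f = "\<lambda>(i, j). mset_set ({..N} - {i<..j}) - c"
    show "?f ` F \<subseteq> ?Q"
    proof
      fix y assume "y \<in> ?f ` F"
      then obtain i j where "(i, j) \<in> F" and y: "y = mset_set ({..N} - {i<..j}) - c" by auto
      then obtain x where "x \<in> ?Q" "c + x = mset_set ({..N} - {i<..j})" by (auto simp: F_def)
      then show "y \<in> ?Q" unfolding y by (metis add_diff_cancel_left')
    qed
    have F_f: "c + ?f (i, j) = mset_set ({..N} - {i<..j})" if "(i, j) \<in> F" for i j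
    proof -
      from that obtain x where x: "c + x = mset_set ({..N} - {i<..j})" by (auto simp: F_def)
      show ?thesis by (simp flip: x)
    qed
    show "inj_on ?f F"
    proof (rule inj_onI, safe)
      fix i j i' j' assume F: "(i, j) \<in> F" "(i', j') \<in> F"
        and "mset_set ({..N} - {i<..j}) - c = mset_set ({..N} - {i'<..j'}) - c"
      then have "mset_set ({..N} - {i<..j}) = mset_set ({..N} - {i'<..j'})"
        using F_f[OF F(1)] F_f[OF F(2)] by simp
      then have "{..N} - {i<..j} = {..N} - {i'<..j'}" by (subst (asm) mset_set_eq_iff) auto
      moreover have b: "i < j" "j \<le> N" "i' < j'" "j' \<le> N" using E F by (auto simp: F_def)
      ultimately have *: "{i<..j} = {i'<..j'}"
        by (metis Diff_Diff_Int atMost_iff greaterThanAtMost_iff inf.absorb_iff2 le_trans subsetI)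
      then show "i = i'" "j = j'" using b by (auto simp: Ioc_inj)
    qed
  qed
  also have "\<dots> \<le> 2 ^ card (term_vars q)"
    using q_sq by (intro card_set_val_squarefree(2) ne) (meson le_add2 le_trans)
  also have "\<dots> \<le> 2 ^ k" using k by simp
  finally obtain \<chi> :: "nat \<Rightarrow> bool" where \<chi>: "\<And>i j. (i, j) \<in> F \<Longrightarrow> \<chi> i \<noteq> \<chi> j"
    using bip[of F] by (auto simp: F_def)
  have "\<exists>(i, j)\<in>F. {..N} - M = {i<..j}"
  proof (rule interval_if_colourings)
    show "{..N} - M \<subseteq> {..N}" by auto
    show "i < j" if "(i, j) \<in> F" for i j using E that by (auto simp: F_def)
    show "\<chi> i \<noteq> \<chi> j" if "(i, j) \<in> F" for i j using \<chi> that .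
    fix \<pi> :: "nat \<Rightarrow> 'a"
    \<comment> \<open>Both \<open>c + w\<close> and \<open>c + x\<close> are the full word with some
      letters deleted. After cancelling \<open>ev c\<close> and the total \<open>?T\<close>,
      comparing \<open>ev w\<close> with \<open>ev x\<close> amounts to comparing the sums of the
      deleted letters.\<close>
    define ev where "ev x = (\<Sum>u\<in>#x. increment \<pi> u)" for x
    have ev_add: "ev (x + y) = ev x + ev y" for x y by (simp add: ev_def)
    have ev_set: "ev (mset_set X) = sum (increment \<pi>) X" for X
      by (simp add: ev_def sum_unfold_sum_mset)
    obtain x y where x: "x \<in> ?Q" "y \<in> {ev x}" "\<theta> y = \<theta> (ev w)"
      using satisfiesD[OF sat, of "\<lambda>x. {ev x}" w \<phi> "ev w"] w
      by (auto simp: ev_add set_plus_def)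
    obtain i j where ij: "(i, j) \<in> E" "c + x = mset_set ({..N} - {i<..j})"
      using q[OF x(1)] by (auto simp: arc_words_def)
    then have "(i, j) \<in> F" using x(1) by (auto simp: F_def)
    let ?T = "sum (increment \<pi>) {..N}"
    have "ev c + ev w = ?T - sum (increment \<pi>) ({..N} - M)"
      using MN by (simp flip: ev_add cw add: ev_set sum_diff double_diff)
    moreover have "ev c + ev x = ?T - (\<pi> j - \<pi> i)"
      using E[OF ij(1)] by (simp flip: ev_add sum_increment add: ij(2) ev_set sum_diff subset_iff)
    ultimately have "ev w = (?T - ev c) - sum (increment \<pi>) ({..N} - M)"
      "ev x = (?T - ev c) - (\<pi> j - \<pi> i)" by (simp_all add: algebra_simps)
    then have "\<theta> ((?T - ev c) - (\<pi> j - \<pi> i)) = \<theta> ((?T - ev c) - sum (increment \<pi>) ({..N} - M))"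
      using x by simp
    then have "\<theta> (sum (increment \<pi>) ({..N} - M)) = \<theta> (\<pi> j - \<pi> i)"
      using shift[of "(?T - ev c) - (\<pi> j - \<pi> i)"
          "(\<pi> j - \<pi> i) + sum (increment \<pi>) ({..N} - M) - (?T - ev c)"
          "(?T - ev c) - sum (increment \<pi>) ({..N} - M)"] by (simp add: algebra_simps)
    then show "\<exists>(i, j)\<in>F. \<theta> (sum (increment \<pi>) ({..N} - M)) = \<theta> (\<pi> j - \<pi> i)"
      using \<open>(i, j) \<in> F\<close> by blast
  qed
  then obtain i j where "(i, j) \<in> F" "{..N} - M = {i<..j}" by auto
  then have "(i, j) \<in> E" "M = {..N} - {i<..j}" using MN by (auto simp: F_def)
  then show ?thesis unfolding cw[symmetric] arc_words_def by blast
qed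

text \<open>Reduction to substitutions of single words: the monomial of \<open>p\<close> behind
  \<open>w\<close> uses each variable at most once, so the words picked in it define a single-valued
  substitution.\<close>

lemma arc_words_closed:
  fixes \<rho> :: "nat \<Rightarrow> nat multiset set"
  assumes E: "\<And>i j. (i, j) \<in> E \<Longrightarrow> i < j \<and> j \<le> N"
    and bip: "\<And>F. F \<subseteq> E \<Longrightarrow> card F \<le> 2 ^ k \<Longrightarrow> \<exists>\<chi> :: nat \<Rightarrow> bool. \<forall>(i, j)\<in>F. \<chi> i \<noteq> \<chi> j"
    and sat: "satisfies (power_semiring H) (p, q)"
    and k: "card (term_vars q) \<le> k"
    and \<rho>: "\<And>n. \<rho> n \<noteq> {}" "\<And>n. {#} \<notin> \<rho> n"
    and q: "\<And>x. x \<in> set_val \<rho> q \<Longrightarrow> c + x \<in> arc_words N E"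
    and w: "w \<in> set_val \<rho> p"
  shows "c + w \<in> arc_words N E"
proof -
  have q': "c + x \<in> arc_words N E" if "\<And>n. \<phi> n \<in> \<rho> n" "x \<in> set_val (\<lambda>n. {\<phi> n}) q" for \<phi> x
    using q set_val_mono[of "\<lambda>n. {\<phi> n}" \<rho> q] that by auto
  obtain M where M: "\<And>n x. (n, x) \<in># M \<Longrightarrow> x \<in> \<rho> n" "w = (\<Sum>(n, x)\<in>#M. x)"
    "\<And>\<phi> :: nat \<Rightarrow> nat multiset. (\<Sum>(n, x)\<in>#M. \<phi> n) \<in> set_val (\<lambda>n. {\<phi> n}) p"
    using set_val_picks[OF w] by blast
  define \<phi>\<^sub>0 where "\<phi>\<^sub>0 n = (SOME x. x \<in> \<rho> n)" for n
  have \<phi>\<^sub>0: "\<phi>\<^sub>0 n \<in> \<rho> n" for n using \<rho>(1) by (simp add: \<phi>\<^sub>0_def some_in_eq)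
  have sq: "count (\<Sum>(n, x)\<in>#M. \<phi>\<^sub>0 n) v \<le> 1" for v
  proof (rule satisfies_linear[OF sat _ M(3)])
    show "count x v \<le> 1" if "x \<in> set_val (\<lambda>n. {\<phi>\<^sub>0 n}) q" for x
      using arc_words_count_le[OF q'[OF \<phi>\<^sub>0 that], of v] by simp
  qed
  \<comment> \<open>No variable is used twice in \<open>w\<close>, hence sets may be replaced by single words.\<close>
  have uniq: "x = y" if xy: "(n, x) \<in># M" "(n, y) \<in># M" for n x y
  proof (rule ccontr)
    assume "x \<noteq> y"
    then have "(n, y) \<in># M - {#(n, x)#}" using xy by (simp add: in_diff_count)
    moreover have "\<phi>\<^sub>0 n \<noteq> {#}" for n using \<phi>\<^sub>0 \<rho>(2) by metis
    ultimately show False using squarefree_sum_unique[OF sq _ xy(1)] by blast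
  qed
  \<comment> \<open>Variables that do not occur in the monomial receive the default word
    \<open>\<phi>\<^sub>0 n\<close>.\<close>
  define \<phi> where "\<phi> n = (if \<exists>x. (n, x) \<in># M then THE x. (n, x) \<in># M else \<phi>\<^sub>0 n)" for n
  have \<phi>_eq: "\<phi> n = x" if "(n, x) \<in># M" for n x
    using that uniq by (auto simp: \<phi>_def)
  have \<phi>: "\<phi> n \<in> \<rho> n" for n
  proof (cases "\<exists>x. (n, x) \<in># M")
    case True
    then show ?thesis using \<phi>_eq M(1) by auto
  next
    case False
    then show ?thesis using \<phi>\<^sub>0 by (simp add: \<phi>_def)
  qed
  have "w = (\<Sum>(n, x)\<in>#M. \<phi> n)"
    unfolding M(2) by (intro arg_cong[where f = sum_mset] image_mset_cong) (auto simp: \<phi>_eq)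
  then have "w \<in> set_val (\<lambda>n. {\<phi> n}) p" using M(3) by simp
  moreover have "\<phi> n \<noteq> {#}" for n using \<phi> \<rho>(2) by metis
  ultimately show ?thesis
    using arc_words_singleton_closed[OF E bip sat k _ q'[OF \<phi>]] by blast
qed

text \<open>\<open>arc_words_closed\<close> places each word of one side in the closure of the other
  side; it is applied in both directions.\<close>

lemma satisfies_syn_semiring:
  assumes E: "\<And>i j. (i, j) \<in> E \<Longrightarrow> i < j \<and> j \<le> N"
    and bip: "\<And>F. F \<subseteq> E \<Longrightarrow> card F \<le> 2 ^ k \<Longrightarrow> \<exists>\<chi> :: nat \<Rightarrow> bool. \<forall>(i, j)\<in>F. \<chi> i \<noteq> \<chi> j"
    and sat: "satisfies (power_semiring H) e"
    and k: "card (identity_vars e) \<le> k"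
  shows "satisfies (syn_semiring (arc_words N E)) e"
  unfolding satisfies_def
proof (intro allI impI)
  let ?L = "arc_words N E"
  fix \<rho> :: "nat \<Rightarrow> nat multiset set" assume "\<forall>n. \<rho> n \<in> carrier (syn_semiring ?L)"
  then have \<rho>: "\<rho> n \<noteq> {}" "{#} \<notin> \<rho> n" "syn_closure ?L (\<rho> n) = \<rho> n" for n
    by (auto simp: syn_semiring_def)
  have val: "term_val (syn_semiring ?L) \<rho> t = syn_closure ?L (set_val \<rho> t)" for t
    using term_val_syn_semiring[of \<rho> ?L t] \<rho> by simp
  have "syn_closure ?L (set_val \<rho> p) \<subseteq> syn_closure ?L (set_val \<rho> q)"
    if pq: "satisfies (power_semiring H) (p, q)" "card (term_vars q) \<le> k" for p q
  proof (rule syn_closure_least, rule subsetI)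
    fix w assume w: "w \<in> set_val \<rho> p"
    have "c + w \<in> ?L" if "\<forall>x\<in>set_val \<rho> q. c + x \<in> ?L" for c
      by (rule arc_words_closed[OF E bip pq \<rho>(1,2) _ w]) (use that in auto)
    moreover have "w \<noteq> {#}" using empty_notin_set_val[of \<rho> p] \<rho>(2) w by auto
    ultimately show "w \<in> syn_closure ?L (set_val \<rho> q)"
      by (simp add: syn_closure_def)
  qed
  moreover have "card (term_vars (fst e)) \<le> k" "card (term_vars (snd e)) \<le> k"
    using card_mono[of "identity_vars e" "term_vars (fst e)"]
      card_mono[of "identity_vars e" "term_vars (snd e)"] k
    by (auto simp: identity_vars_def)
  moreover have "satisfies (power_semiring H) (fst e, snd e)"
    "satisfies (power_semiring H) (snd e, fst e)"
    using sat by (auto simp: satisfies_def)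
  ultimately show "term_val (syn_semiring ?L) \<rho> (fst e) = term_val (syn_semiring ?L) \<rho> (snd e)"
    unfolding val by (intro equalityI) auto
qed

end

section \<open>The identity of a digraph\<close>

text \<open>The first variable is a separate argument because there is no term for the empty
  product.\<close>

primrec prod_term :: "nat \<Rightarrow> nat list \<Rightarrow> ai_term" where
  "prod_term x [] = Var x"
| "prod_term x (y # ys) = Prod (Var x) (prod_term y ys)"

definition arc_term :: "nat \<Rightarrow> nat \<times> nat \<Rightarrow> ai_term" where
  "arc_term N = (\<lambda>(i, j). prod_term 0 ([1..<Suc i] @ [Suc j..<Suc N]))"

text \<open>The inequality between the full product and the sum over all arcs, written as an
  equation. The arc \<open>a\<close> is singled out because there is no empty sum.\<close>

definition arc_identity :: "nat \<Rightarrow> nat \<times> nat \<Rightarrow> (nat \<times> nat) list \<Rightarrow> identity" where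
  "arc_identity N a as =
     (let s = foldr Sum (map (arc_term N) as) (arc_term N a) in (Sum (prod_term 0 [1..<Suc N]) s, s))"

lemma set_val_prod_term: "set_val (\<lambda>n. {{#n#}}) (prod_term x xs) = {mset (x # xs)}"
  by (induction xs arbitrary: x) (auto simp: set_plus_def)

lemma set_val_foldr_Sum:
  "set_val \<rho> (foldr Sum ts t) = set_val \<rho> t \<union> (\<Union>s\<in>set ts. set_val \<rho> s)"
  by (induction ts) auto

lemma upt_arc: "i < j \<Longrightarrow> j \<le> N \<Longrightarrow> set (0 # [1..<Suc i] @ [Suc j..<Suc N]) = {..N} - {i<..j}"
  by auto

lemma set_val_arc_term:
  assumes "i < j" "j \<le> N"
  shows "set_val (\<lambda>n. {{#n#}}) (arc_term N (i, j)) = {mset_set ({..N} - {i<..j})}"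
proof -
  have "distinct (0 # [1..<Suc i] @ [Suc j..<Suc N])" using assms by auto
  then have "mset (0 # [1..<Suc i] @ [Suc j..<Suc N]) = mset_set ({..N} - {i<..j})"
    using mset_set_set[of "0 # [1..<Suc i] @ [Suc j..<Suc N]"] by (simp only: upt_arc[OF assms])
  then show ?thesis by (simp add: arc_term_def set_val_prod_term del: upt_Suc)
qed

text \<open>At the generators the right hand side evaluates to exactly \<open>L\<close>. The empty
  context then separates the full word from it, since every arc \<open>(i, j)\<close> deletes at
  least the letter \<open>j\<close>.\<close>

lemma arc_identity_fails:
  assumes E: "\<And>i j. (i, j) \<in> set (a # as) \<Longrightarrow> i < j \<and> j \<le> N"
  shows "\<not> satisfies (syn_semiring (arc_words N (set (a # as)))) (arc_identity N a as)"
proof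
  let ?L = "arc_words N (set (a # as))"
  let ?\<sigma> = "\<lambda>n :: nat. {{#n#}}"
  let ?s = "prod_term 0 [1..<Suc N]"
  let ?t = "foldr Sum (map (arc_term N) as) (arc_term N a)"
  assume sat: "satisfies (syn_semiring ?L) (arc_identity N a as)"
  have "set_val ?\<sigma> ?t = (\<Union>e\<in>set (a # as). set_val ?\<sigma> (arc_term N e))"
    by (auto simp: set_val_foldr_Sum)
  also have "\<dots> = (\<Union>(i, j)\<in>set (a # as). {mset_set ({..N} - {i<..j})})"
    by (rule SUP_cong) (use E set_val_arc_term in \<open>auto simp del: list.set\<close>)
  also have "\<dots> = ?L" by (auto simp: arc_words_def simp del: list.set)
  finally have t: "set_val ?\<sigma> ?t = ?L" .
  have "syn_closure ?L (?\<sigma> n) \<in> carrier (syn_semiring ?L)" for n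
    using syn_closure_increasing[of "?\<sigma> n" ?L] by (auto simp: syn_semiring_def)
  then have "term_val (syn_semiring ?L) (\<lambda>n. syn_closure ?L (?\<sigma> n)) (Sum ?s ?t)
      = term_val (syn_semiring ?L) (\<lambda>n. syn_closure ?L (?\<sigma> n)) ?t"
    using sat by (auto simp: satisfies_def arc_identity_def Let_def)
  then have eq: "syn_closure ?L (set_val ?\<sigma> (Sum ?s ?t)) = syn_closure ?L (set_val ?\<sigma> ?t)"
    by (simp only: term_val_syn_semiring[of ?\<sigma>] singleton_iff empty_not_add_mset not_False_eq_True)
  have "{#} \<notin> set_val ?\<sigma> (Sum ?s ?t)" by (rule empty_notin_set_val) auto
  from syn_closure_increasing[OF this, of ?L]
  have "mset (0 # [1..<Suc N]) \<in> syn_closure ?L ?L"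
    unfolding eq t by (auto simp: set_val_prod_term simp del: upt_Suc mset.simps)
  then have "mset (0 # [1..<Suc N]) \<in> ?L" by (auto simp: syn_closure_def dest!: spec[of _ "{#}"])
  then obtain i j where ij: "(i, j) \<in> set (a # as)" "mset (0 # [1..<Suc N]) = mset_set ({..N} - {i<..j})"
    by (auto simp: arc_words_def simp del: mset.simps)
  then have "set (0 # [1..<Suc N]) = {..N} - {i<..j}"
    by (metis finite_Diff finite_atMost finite_set_mset_mset_set set_mset_mset)
  moreover have "j \<in> set (0 # [1..<Suc N])" using E[OF ij(1)] by auto
  ultimately show False using E[OF ij(1)] by auto
qed

section \<open>Products of lists in groups and in power semirings\<close>

definition list_mult :: "('g, 'b) monoid_scheme \<Rightarrow> 'g list \<Rightarrow> 'g" where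
  "list_mult G xs = foldr (\<otimes>\<^bsub>G\<^esub>) xs \<one>\<^bsub>G\<^esub>"

context monoid
begin

lemma list_mult_closed [simp]: "set xs \<subseteq> carrier G \<Longrightarrow> list_mult G xs \<in> carrier G"
  by (induction xs) (auto simp: list_mult_def)

lemma list_mult_append:
  "set xs \<subseteq> carrier G \<Longrightarrow> set ys \<subseteq> carrier G \<Longrightarrow>
    list_mult G (xs @ ys) = list_mult G xs \<otimes> list_mult G ys"
proof (induction xs)
  case Nil
  then show ?case using list_mult_closed[of ys] by (simp add: list_mult_def)
next
  case (Cons x xs)
  then show ?case using list_mult_closed[of ys] list_mult_closed[of xs]
    by (simp add: list_mult_def m_assoc)
qed

text \<open>As the variables are distinct, the factors chosen at the individual positions can be
  collected in one function of the variable.\<close>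

lemma prod_term_powerD:
  assumes "\<And>n. \<rho> n \<subseteq> carrier G"
    and "g \<in> term_val (power_semiring0 G) \<rho> (prod_term x xs)" "distinct (x # xs)"
  shows "\<exists>a. (\<forall>y\<in>set (x # xs). a y \<in> \<rho> y) \<and> g = list_mult G (map a (x # xs))"
  using assms(2,3)
proof (induction xs arbitrary: x g)
  case Nil
  then show ?case using assms(1)[of x] by (intro exI[of _ "\<lambda>_. g"]) (auto simp: list_mult_def)
next
  case (Cons y ys)
  from Cons.prems(1) obtain h g' where h: "h \<in> \<rho> x" "g = h \<otimes> g'"
    "g' \<in> term_val (power_semiring0 G) \<rho> (prod_term y ys)"
    by (auto simp: power_semiring0_def set_mult_def)
  obtain a where a: "\<forall>z\<in>set (y # ys). a z \<in> \<rho> z" "g' = list_mult G (map a (y # ys))"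
    using Cons.IH[OF h(3)] Cons.prems(2) by auto
  have "list_mult G (map (a(x := h)) (x # y # ys)) = h \<otimes> list_mult G (map (a(x := h)) (y # ys))"
    by (simp add: list_mult_def)
  also have "map (a(x := h)) (y # ys) = map a (y # ys)" using Cons.prems(2) by auto
  finally have "g = list_mult G (map (a(x := h)) (x # y # ys))"
    unfolding h(2) a(2) by (rule sym)
  moreover have "\<forall>z\<in>set (x # y # ys). (a(x := h)) z \<in> \<rho> z" using h(1) a(1) by auto
  ultimately show ?case by blast
qed

lemma prod_term_powerI:
  assumes "\<And>n. \<rho> n \<subseteq> carrier G" "\<forall>y\<in>set (x # xs). a y \<in> \<rho> y"
  shows "list_mult G (map a (x # xs)) \<in> term_val (power_semiring0 G) \<rho> (prod_term x xs)"
  using assms(2)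
proof (induction xs arbitrary: x)
  case Nil
  then show ?case using assms(1)[of x] by (auto simp: list_mult_def)
next
  case (Cons y ys)
  then have "list_mult G (map a (y # ys)) \<in> term_val (power_semiring0 G) \<rho> (prod_term y ys)" by simp
  then show ?case using Cons.prems by (auto simp: list_mult_def power_semiring0_def set_mult_def)
qed

end

lemma term_val_power_foldr_Sum:
  "term_val (power_semiring0 G) \<rho> (foldr Sum ts t)
    = term_val (power_semiring0 G) \<rho> t \<union> (\<Union>s\<in>set ts. term_val (power_semiring0 G) \<rho> s)"
  by (induction ts) (auto simp: power_semiring0_def)

lemma power_semiring0_arc_identity:
  assumes G: "group G" "finite (carrier G)" "card (carrier G) \<le> n"
    and E: "\<And>i j. (i, j) \<in> set (a # as) \<Longrightarrow> i < j \<and> j \<le> N"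
    and col: "\<And>p :: nat \<Rightarrow> nat. (\<forall>i. p i < n) \<Longrightarrow> \<exists>(i, j)\<in>set (a # as). p i = p j"
  shows "satisfies (power_semiring0 G) (arc_identity N a as)"
  unfolding satisfies_def
proof (intro allI impI)
  interpret group G by fact
  let ?P = "power_semiring0 G"
  fix \<rho> :: "nat \<Rightarrow> _" assume "\<forall>n. \<rho> n \<in> carrier ?P"
  then have \<rho>: "\<rho> n \<subseteq> carrier G" for n by (auto simp: power_semiring0_def)
  let ?s = "prod_term 0 [1..<Suc N]"
  let ?t = "foldr Sum (map (arc_term N) as) (arc_term N a)"
  have "term_val ?P \<rho> ?s \<subseteq> term_val ?P \<rho> ?t"
  proof
    fix g assume "g \<in> term_val ?P \<rho> ?s"
    moreover have "distinct (0 # [1..<Suc N])" by simp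
    ultimately obtain c where c': "\<forall>y\<in>set (0 # [1..<Suc N]). c y \<in> \<rho> y"
      and g: "g = list_mult G (map c (0 # [1..<Suc N]))"
      using prod_term_powerD[of \<rho>, OF \<rho>] by blast
    have c: "c y \<in> \<rho> y" if "y \<le> N" for y using c' that by (cases y) auto
    have cG: "c y \<in> carrier G" if "y \<le> N" for y using c[OF that] \<rho> by blast
    define pre where "pre i = list_mult G (map c [0..<Suc i])" for i
    obtain h where h: "bij_betw h (carrier G) {0..<card (carrier G)}"
      using ex_bij_betw_finite_nat[OF G(2)] by blast
    have pre_closed: "pre i \<in> carrier G" if "i \<le> N" for i
      unfolding pre_def using that cG by (intro list_mult_closed) auto
    \<comment> \<open>The colour of \<open>i\<close> is the number of the prefix product. The unit
      beyond \<open>N\<close> only makes the colouring total, as arcs stay within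
      \<open>{..N}\<close>.\<close>
    have "\<forall>i. h (if i \<le> N then pre i else \<one>\<^bsub>G\<^esub>) < n"
    proof
      fix i
      have "(if i \<le> N then pre i else \<one>\<^bsub>G\<^esub>) \<in> carrier G" using pre_closed by simp
      then show "h (if i \<le> N then pre i else \<one>\<^bsub>G\<^esub>) < n" using bij_betwE[OF h] G(3) by force
    qed
    from col[OF this] obtain i j where ij: "(i, j) \<in> set (a # as)"
      "h (if i \<le> N then pre i else \<one>\<^bsub>G\<^esub>) = h (if j \<le> N then pre j else \<one>\<^bsub>G\<^esub>)" by blast
    have ijN: "i < j" "j \<le> N" using E[OF ij(1)] by auto
    then have "h (pre i) = h (pre j)" using ij(2) by simp
    then have pre_eq: "pre i = pre j"
      using inj_onD[OF bij_betw_imp_inj_on[OF h]] pre_closed ijN by simp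
    have split: "0 # [1..<Suc N] = [0..<Suc j] @ [Suc j..<Suc N]"
      using ijN upt_add_eq_append[of 0 "Suc j" "N - j"] by (simp add: upt_conv_Cons del: upt_Suc)
    have split': "0 # ([1..<Suc i] @ [Suc j..<Suc N]) = [0..<Suc i] @ [Suc j..<Suc N]"
      by (simp add: upt_conv_Cons del: upt_Suc)
    \<comment> \<open>Replacing \<open>pre j\<close> by the equal element \<open>pre i\<close>
      removes the factors with indices in \<open>{i<..j}\<close>.\<close>
    have "g = pre j \<otimes>\<^bsub>G\<^esub> list_mult G (map c [Suc j..<Suc N])"
      unfolding g split map_append pre_def using cG ijN by (intro list_mult_append) auto
    also have "\<dots> = pre i \<otimes>\<^bsub>G\<^esub> list_mult G (map c [Suc j..<Suc N])" by (simp only: pre_eq)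
    also have "\<dots> = list_mult G (map c (0 # ([1..<Suc i] @ [Suc j..<Suc N])))"
      unfolding split' map_append pre_def
      using cG ijN by (intro list_mult_append[symmetric]) auto
    also have "\<dots> \<in> term_val ?P \<rho> (arc_term N (i, j))"
      unfolding arc_term_def split_conv
      by (rule prod_term_powerI[OF \<rho>]) (use c ijN in auto)
    finally show "g \<in> term_val ?P \<rho> ?t"
      using ij(1) by (auto simp: term_val_power_foldr_Sum)
  qed
  then show "term_val ?P \<rho> (fst (arc_identity N a as)) = term_val ?P \<rho> (snd (arc_identity N a as))"
    by (auto simp: arc_identity_def Let_def power_semiring0_def)
qed

section \<open>Adjoining a zero\<close>

definition term_algebra :: "ai_term ai_semiring" where
  "term_algebra = \<lparr>carrier = UNIV, plus_op = Sum, times_op = Prod\<rparr>"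

text \<open>What remains of a term, as a formal term, when the variables in \<open>Z\<close> become
  zero: the monomials that avoid \<open>Z\<close>, or \<open>None\<close> if there are none.
  \<open>term_algebra\<close> only supplies the free operations for this; it does not satisfy the
  semiring laws.\<close>

definition kill_vars :: "nat set \<Rightarrow> ai_term \<Rightarrow> ai_term option" where
  "kill_vars Z = term_val (adjoin_zero term_algebra) (\<lambda>n. if n \<in> Z then None else Some (Var n))"

lemma term_val_adjoin_zero:
  "term_val (adjoin_zero S) (\<lambda>n. if n \<in> Z then None else Some (\<sigma> n)) t
    = map_option (term_val S \<sigma>) (kill_vars Z t)"
proof (induction t)
  case (Sum s t)
  then show ?case
    by (cases "kill_vars Z s"; cases "kill_vars Z t")
      (auto simp: kill_vars_def adjoin_zero_def term_algebra_def)
next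
  case (Prod s t)
  then show ?case
    by (cases "kill_vars Z s"; cases "kill_vars Z t")
      (auto simp: kill_vars_def adjoin_zero_def term_algebra_def)
qed (simp add: kill_vars_def)

text \<open>The empty set is neutral for union and absorbing for products, so it behaves like an
  adjoined zero.\<close>

lemma term_val_power_semiring0:
  "term_val (power_semiring0 G) (\<lambda>n. if n \<in> Z then {} else \<sigma> n) t
    = (case kill_vars Z t of None \<Rightarrow> {} | Some t' \<Rightarrow> term_val (power_semiring0 G) \<sigma> t')"
proof (induction t)
  case (Sum s t)
  then show ?case
    by (cases "kill_vars Z s"; cases "kill_vars Z t")
      (auto simp: kill_vars_def adjoin_zero_def term_algebra_def power_semiring0_def)
next
  case (Prod s t)
  then show ?case
    by (cases "kill_vars Z s"; cases "kill_vars Z t")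
      (auto simp: kill_vars_def adjoin_zero_def term_algebra_def power_semiring0_def set_mult_def)
qed (simp add: kill_vars_def)

lemma (in group) term_val_power_semiring0_one:
  "term_val (power_semiring0 G) (\<lambda>_. {\<one>}) t = {\<one>}"
  by (induction t) (auto simp: power_semiring0_def set_mult_def)

text \<open>Setting variables to zero turns an identity of the generators into another one, because
  the generators already contain a zero. The reduced identity therefore holds in
  \<open>S\<close>.\<close>

lemma satisfies_adjoin_zero:
  assumes K: "K \<noteq> {}" "\<And>G. G \<in> K \<Longrightarrow> group G"
    and S: "S \<in> models (identities (power_semiring0 ` K))"
    and e: "e \<in> identities (power_semiring0 ` K)"
  shows "satisfies (adjoin_zero S) e"
  unfolding satisfies_def
proof (intro allI impI)
  fix \<rho> :: "nat \<Rightarrow> _" assume \<rho>: "\<forall>n. \<rho> n \<in> carrier (adjoin_zero S)"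
  define Z where "Z = {n. \<rho> n = None}"
  obtain a where a: "a \<in> carrier S" using S by (auto simp: models_def is_ai_semiring_def)
  define \<sigma> where "\<sigma> n = (if n \<in> Z then a else the (\<rho> n))" for n
  have \<sigma>: "\<sigma> n \<in> carrier S" for n
    using \<rho>[rule_format, of n] a by (auto simp: \<sigma>_def Z_def adjoin_zero_def)
  have \<rho>_eq: "\<rho> = (\<lambda>n. if n \<in> Z then None else Some (\<sigma> n))"
    by (auto simp: fun_eq_iff \<sigma>_def Z_def)
  have eP: "(case kill_vars Z (fst e) of None \<Rightarrow> {} | Some t \<Rightarrow> term_val (power_semiring0 G) \<tau> t)
      = (case kill_vars Z (snd e) of None \<Rightarrow> {} | Some t \<Rightarrow> term_val (power_semiring0 G) \<tau> t)"
    if "G \<in> K" "\<forall>n. \<tau> n \<in> carrier (power_semiring0 G)" for G \<tau>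
  proof -
    have sat: "satisfies (power_semiring0 G) e" using e that(1) by (auto simp: identities_def)
    have "term_val (power_semiring0 G) (\<lambda>n. if n \<in> Z then {} else \<tau> n) (fst e)
        = term_val (power_semiring0 G) (\<lambda>n. if n \<in> Z then {} else \<tau> n) (snd e)"
      by (rule sat[unfolded satisfies_def, rule_format])
        (use that(2) in \<open>auto simp: power_semiring0_def\<close>)
    then show ?thesis unfolding term_val_power_semiring0 .
  qed
  obtain G where "G \<in> K" using K(1) by blast
  then interpret group G using K(2) by blast
  \<comment> \<open>If all surviving variables are \<open>{\<one>}\<close>, a side evaluates to
    \<open>{\<one>}\<close> or to the empty set according to whether anything of it survives. So
    both sides survive or neither does.\<close>
  have "\<forall>n. {\<one>\<^bsub>G\<^esub>} \<in> carrier (power_semiring0 G)" by (simp add: power_semiring0_def)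
  note one = eP[OF \<open>G \<in> K\<close> this, unfolded term_val_power_semiring0_one]
  consider "kill_vars Z (fst e) = None" "kill_vars Z (snd e) = None"
    | s t where "kill_vars Z (fst e) = Some s" "kill_vars Z (snd e) = Some t"
    using one by (cases "kill_vars Z (fst e)"; cases "kill_vars Z (snd e)") auto
  then show "term_val (adjoin_zero S) \<rho> (fst e) = term_val (adjoin_zero S) \<rho> (snd e)"
  proof cases
    case 1
    then show ?thesis unfolding \<rho>_eq by (simp add: term_val_adjoin_zero)
  next
    case (2 s t)
    have "(s, t) \<in> identities (power_semiring0 ` K)"
      using eP 2 by (auto simp: identities_def satisfies_def)
    then have "satisfies S (s, t)" using S by (auto simp: models_def)
    then have "term_val S \<sigma> s = term_val S \<sigma> t" using \<sigma> by (auto simp: satisfies_def)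
    then show ?thesis unfolding \<rho>_eq using 2 by (simp add: term_val_adjoin_zero)
  qed
qed

section \<open>Axiomatic rank\<close>

lemma identities_antimono: "K \<subseteq> K' \<Longrightarrow> identities K' \<subseteq> identities K"
  by (auto simp: identities_def)

lemma models_antimono: "\<Sigma> \<subseteq> \<Sigma>' \<Longrightarrow> models \<Sigma>' \<subseteq> models \<Sigma>"
  by (auto simp: models_def)

lemma infinite_axiomatic_rank_not_finitely_based:
  assumes "infinite_axiomatic_rank V"
  shows "\<not> finitely_based V"
proof
  assume "finitely_based V"
  then obtain \<Sigma> where \<Sigma>: "finite \<Sigma>" "is_basis \<Sigma> V" by (auto simp: finitely_based_def)
  \<comment> \<open>The inserted \<open>0\<close> covers an empty \<Sigma>, and \<open>Suc\<close>
    makes \<open>k\<close> positive.\<close>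
  define k where "k = Suc (Max (insert 0 ((\<lambda>e. card (identity_vars e)) ` \<Sigma>)))"
  let ?T = "{e \<in> identities V. card (identity_vars e) \<le> k}"
  have "card (identity_vars e) \<le> k" if "e \<in> \<Sigma>" for e
    unfolding k_def using \<Sigma>(1) that by (intro le_SucI Max_ge) auto
  then have "\<Sigma> \<subseteq> ?T" using \<Sigma>(2) by (auto simp: is_basis_def)
  then have "identities (models \<Sigma> :: 'a ai_semiring set) \<subseteq> identities (models ?T :: 'a ai_semiring set)"
    by (intro identities_antimono models_antimono)
  then have "is_basis ?T V" using \<Sigma>(2) by (auto simp: is_basis_def)
  moreover have "k \<ge> 1" by (simp add: k_def)
  ultimately show False using assms by (auto simp: infinite_axiomatic_rank_def)
qed

text \<open>The witness \<open>A\<close> may live in a universe different from that of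
  \<open>V\<close>; the consequences of the identities in at most \<open>k\<close> variables are
  transferred by \<open>identities_models_universe\<close>.\<close>

lemma infinite_axiomatic_rankI:
  fixes V :: "'u ai_semiring set"
  assumes inf: "infinite (UNIV :: 'u set)"
    and "\<And>k. \<exists>(A :: 'a ai_semiring) e. is_ai_semiring A \<and> e \<in> identities V \<and> \<not> satisfies A e \<and>
      (\<forall>d\<in>identities V. card (identity_vars d) \<le> k \<longrightarrow> satisfies A d)"
  shows "infinite_axiomatic_rank V"
  unfolding infinite_axiomatic_rank_def
proof (intro allI impI notI)
  fix k :: nat
  let ?T = "{e \<in> identities V. card (identity_vars e) \<le> k}"
  assume "is_basis ?T V"
  then have basis: "identities V \<subseteq> identities (models ?T :: 'u ai_semiring set)"
    by (simp add: is_basis_def)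
  obtain A :: "'a ai_semiring" and e where A: "is_ai_semiring A" "e \<in> identities V" "\<not> satisfies A e"
    "\<forall>d\<in>identities V. card (identity_vars d) \<le> k \<longrightarrow> satisfies A d"
    using assms(2) by blast
  have "A \<in> models ?T" using A by (auto simp: models_def)
  moreover have "e \<in> identities (models ?T :: 'a ai_semiring set)"
    using A(2) basis identities_models_universe[OF inf, of ?T] by blast
  ultimately show False using A(3) by (auto simp: identities_def)
qed

text \<open>The nontrivial inclusion passes through the variety generated in the universe of
  \<open>K\<close>, where the generators themselves are members.\<close>

lemma identities_generated_variety:
  fixes K :: "'b ai_semiring set"
  assumes inf: "infinite (UNIV :: 'u set)" and K: "\<And>S. S \<in> K \<Longrightarrow> is_ai_semiring S"
  shows "identities (generated_variety K :: 'u ai_semiring set) = identities K"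
proof
  have "identities (generated_variety K :: 'u ai_semiring set)
      \<subseteq> identities (generated_variety K :: 'b ai_semiring set)"
    unfolding generated_variety_def by (rule identities_models_universe[OF inf])
  also have "\<dots> \<subseteq> identities K"
    using generated_variety_contains[OF K] by (auto simp: identities_def)
  finally show "identities (generated_variety K :: 'u ai_semiring set) \<subseteq> identities K" .
qed (auto simp: generated_variety_def models_def identities_def)

lemma ex_local_failure:
  fixes H :: "'h monoid" and Gs :: "'g monoid set"
  assumes H: "group H" "finite (carrier H)" "order H \<ge> 3"
    and Gs: "finite Gs" "\<And>G. G \<in> Gs \<Longrightarrow> group G \<and> finite (carrier G)"
  shows "\<exists>(A :: nat multiset set ai_semiring) e. is_ai_semiring A \<and> \<not> satisfies A e \<and>
    (\<forall>G\<in>Gs. satisfies (power_semiring0 G) e) \<and>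
    (\<forall>d. satisfies (power_semiring H) d \<longrightarrow> card (identity_vars d) \<le> k \<longrightarrow> satisfies A d)"
proof -
  \<comment> \<open>\<open>n\<close> bounds the orders of all groups in \<open>Gs\<close>, and it is
    positive, so the constant colouring is admissible and shows that \<open>E\<close> has an
    arc.\<close>
  define n where "n = Suc (\<Sum>G\<in>Gs. card (carrier G))"
  obtain E :: "(nat \<times> nat) set" where E: "finite E" "\<And>i j. (i, j) \<in> E \<Longrightarrow> i < j"
    and bip: "\<And>F. F \<subseteq> E \<Longrightarrow> card F \<le> 2 ^ k \<Longrightarrow> \<exists>\<chi> :: nat \<Rightarrow> bool. \<forall>(i, j)\<in>F. \<chi> i \<noteq> \<chi> j"
    and col: "\<And>p :: nat \<Rightarrow> nat. (\<forall>i. p i < n) \<Longrightarrow> \<exists>(i, j)\<in>E. p i = p j"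
    using ex_locally_bipartite_digraph[of "2 ^ k" n] by auto
  have "E \<noteq> {}" using col[of "\<lambda>_. 0"] by (auto simp: n_def)
  moreover obtain xs where "set xs = E" using finite_list[OF E(1)] by blast
  ultimately obtain a as where as: "set (a # as) = E" by (cases xs) auto
  define N where "N = Max (snd ` E)"
  have EN: "i < j \<and> j \<le> N" if "(i, j) \<in> E" for i j
  proof -
    have "j \<in> snd ` E" using that by (rule rev_image_eqI) simp
    then have "j \<le> N" unfolding N_def using E(1) by (intro Max_ge) auto
    then show ?thesis using E(2)[OF that] by simp
  qed
  obtain \<theta> :: "int \<times> int \<Rightarrow> 'h" where "large_hom H \<theta>" using ex_large_hom[OF H] by blast
  then interpret large_hom H \<theta> .
  have "satisfies (power_semiring0 G) (arc_identity N a as)" if "G \<in> Gs" for G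
  proof (rule power_semiring0_arc_identity)
    have "card (carrier G) \<le> (\<Sum>G\<in>Gs. card (carrier G))"
      using that Gs(1) by (intro member_le_sum) auto
    then show "card (carrier G) \<le> n" by (simp add: n_def)
    show "group G" "finite (carrier G)" using Gs(2) that by auto
    show "i < j \<and> j \<le> N" if "(i, j) \<in> set (a # as)" for i j using EN that unfolding as .
    show "\<exists>(i, j)\<in>set (a # as). p i = p j" if "\<forall>i. p i < n" for p using col that unfolding as .
  qed
  moreover have "\<not> satisfies (syn_semiring (arc_words N E)) (arc_identity N a as)"
    using arc_identity_fails[of a as N] EN unfolding as by blast
  moreover have "satisfies (syn_semiring (arc_words N E)) d"
    if "satisfies (power_semiring H) d" "card (identity_vars d) \<le> k" for d
    using satisfies_syn_semiring[OF EN bip that] .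
  ultimately show ?thesis using is_ai_semiring_syn_semiring[of "arc_words N E"] by blast
qed

theorem corollary7p2:
  fixes G :: "nat \<Rightarrow> 'g monoid" and t :: nat
    and H :: "'h monoid"
    and \<U> \<W> :: "'u ai_semiring set"
  assumes universe: "infinite (UNIV :: 'u set)"
    and "t \<ge> 1"
    and G: "\<And>i. i \<in> {1..t} \<Longrightarrow> group (G i) \<and> finite (carrier (G i))"
    and W: "\<W> = generated_variety ((\<lambda>i. power_semiring0 (G i)) ` {1..t})"
    and H: "group H" "finite (carrier H)" "order H \<ge> 3"
    and U: "is_variety \<U>" "generated_variety {power_semiring H} \<subseteq> \<U>" "\<U> \<subseteq> \<W>"
  shows "variety0 \<U> \<subseteq> \<W> \<and>
    (\<forall>\<V> :: 'u ai_semiring set. is_variety \<V> \<and> \<U> \<subseteq> \<V> \<and> \<V> \<subseteq> variety0 \<U> \<longrightarrow>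
       infinite_axiomatic_rank \<V> \<and> \<not> finitely_based \<V>)"
proof -
  define Gs where "Gs = G ` {1..t}"
  have Gs: "finite Gs" "Gs \<noteq> {}" "\<And>G. G \<in> Gs \<Longrightarrow> group G \<and> finite (carrier G)"
    using G \<open>t \<ge> 1\<close> by (auto simp: Gs_def)
  have W': "\<W> = models (identities (power_semiring0 ` Gs))"
    by (simp add: W Gs_def generated_variety_def image_image)
  have "identities (power_semiring0 ` Gs) \<subseteq> identities (adjoin_zero ` \<U>)"
  proof
    fix e assume e: "e \<in> identities (power_semiring0 ` Gs)"
    have "satisfies (adjoin_zero S) e" if "S \<in> \<U>" for S
    proof (rule satisfies_adjoin_zero[OF Gs(2) _ _ e])
      show "S \<in> models (identities (power_semiring0 ` Gs))" using that U(3) W' by blast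
    qed (use Gs(3) in blast)
    then show "e \<in> identities (adjoin_zero ` \<U>)" by (auto simp: identities_def)
  qed
  then have 1: "variety0 \<U> \<subseteq> \<W>"
    unfolding variety0_def generated_variety_def W' models_def by blast
  \<comment> \<open>The identities of \<V> lie between those of \<W> and those of
    \<open>power_semiring H\<close>: the failing identity \<open>e\<close> is inherited from \<W>,
    while identities of \<V> in at most \<open>k\<close> variables hold in
    \<open>power_semiring H\<close> and hence in \<open>A\<close>.\<close>
  have "infinite_axiomatic_rank \<V>" if V: "\<U> \<subseteq> \<V>" "\<V> \<subseteq> variety0 \<U>" for \<V>
  proof (rule infinite_axiomatic_rankI[OF universe])
    fix k
    obtain A :: "nat multiset set ai_semiring" and e where
      A: "is_ai_semiring A" "\<not> satisfies A e" "\<forall>G\<in>Gs. satisfies (power_semiring0 G) e"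
      "\<And>d. satisfies (power_semiring H) d \<Longrightarrow> card (identity_vars d) \<le> k \<Longrightarrow> satisfies A d"
      using ex_local_failure[OF H Gs(1,3)] by blast
    have "e \<in> identities (power_semiring0 ` Gs)" using A(3) by (simp add: identities_def)
    moreover have "\<V> \<subseteq> models (identities (power_semiring0 ` Gs))" using V(2) 1 W' by blast
    ultimately have "e \<in> identities \<V>" by (auto simp: identities_def[of \<V>] models_def)
    moreover have "satisfies (power_semiring H) d" if "d \<in> identities \<V>" for d
    proof -
      have "d \<in> identities (generated_variety {power_semiring H} :: 'u ai_semiring set)"
        using that V(1) U(2) by (auto simp: identities_def)
      then have "d \<in> identities {power_semiring H}"
        using is_ai_semiring_power_semiring[OF H(1)]
        by (subst (asm) identities_generated_variety[OF universe]) auto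
      then show ?thesis by (simp add: identities_def)
    qed
    ultimately show "\<exists>(A :: nat multiset set ai_semiring) e. is_ai_semiring A \<and> e \<in> identities \<V> \<and>
        \<not> satisfies A e \<and> (\<forall>d\<in>identities \<V>. card (identity_vars d) \<le> k \<longrightarrow> satisfies A d)"
      using A by blast
  qed
  then show ?thesis using 1 infinite_axiomatic_rank_not_finitely_based by blast
qed

end
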